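(* Consider the plant model described in the context, with infinite buffer capacity, and suppose that $\mathbb{E}\{Q_m(0)\}<\infty$ for all $m\in\{1,\ldots,M\}$. Then under any control algorithm (any rule for choosing $\boldsymbol{A}(t),\boldsymbol{Z}(t),\boldsymbol{P}(t)$ and the scheduling decisions $\tilde{\boldsymbol{D}}(t)$ consistent with the model), the time average achieved profit satisfies $$\limsup_{t\rightarrow\infty}\frac1t\sum_{\tau=0}^{t-1}\mathbb{E}\{\phi_{actual}(\tau)\}\le\phi^{opt},$$ where $\phi^{opt}$ is the maximum value of the objective of the following optimization problem in the auxiliary variables $\hat c,\hat r,\theta(\boldsymbol a,x),\hat a_m,\hat\mu_m$ (for $x\in\mathcal X$, $\boldsymbol a\in\mathcal A(x)$, $m\in\{1,\ldots,M\}$) and in the conditional distributions described below: Maximize $\phi$ subject to $$\phi=-\hat c+\hat r,\qquad \hat a_m\ge\hat\mu_m\ \ \forall m,$$ $$\hat c=\sum_{x\in\mathcal X}\pi(x)\sum_{\boldsymbol a\in\mathcal A(x)}\theta(\boldsymbol a,x)c(\boldsymbol a,x),$$ $$\hat r=\sum_{y\in\mathcal Y}\pi(y)\sum_{k=1}^K\mathbb{E}\{Z_k(t)(P_k(t)-\alpha_k)F_k(P_k(t),y)\mid Y(t)=y\},$$ $$\hat a_m=\sum_{x\in\mathcal X}\pi(x)\sum_{\boldsymbol a\in\mathcal A(x)}\theta(\boldsymbol a,x)a_m\ \ \forall m,$$ $$\hat\mu_m=\sum_{y\in\mathcal Y}\pi(y)\sum_{k=1}^K\beta_{mk}\mathbb{E}\{Z_k(t)F_k(P_k(t),y)\mid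 Y(t)=y\}\ \ \forall m,$$ $$0\le\theta(\boldsymbol a,x)\le1\ \ \forall x\in\mathcal X,\boldsymbol a\in\mathcal A(x),\qquad \sum_{\boldsymbol a\in\mathcal A(x)}\theta(\boldsymbol a,x)=1\ \ \forall x\in\mathcal X,$$ $$P_k(t)\in\mathcal P_k,\quad Z_k(t)\in\{0,1\}\quad\forall k,t,$$ where $\boldsymbol P(t)=(P_1(t),\ldots,P_K(t))$ and $\boldsymbol Z(t)=(Z_1(t),\ldots,Z_K(t))$ are random vectors whose conditional distribution may be chosen as any distribution depending only on the observed value $Y(t)=y$, and the expectations are with respect to these chosen conditional distributions.
   Context: **Plant model.** There are $M$ raw materials, $K$ products, and time slots $t\in\{0,1,2,\ldots\}$. The nonnegative integer $\beta_{mk}$ is the number of units of material $m$ needed to assemble one unit of product $k$; $\alpha_k\ge0$ is the cost of assembling one unit of product $k$. *Supply and purchasing.* The supply state $X(t)=[(x_1(t),\ldots,x_M(t));(s_1(t),\ldots,s_M(t))]$ takes values in a finite or countably infinite set $\mathcal X$; $x_m(t)\ge0$ is the per-unit price of material $m$ and $s_m(t)\geq 0$ the amount available on slot $t$. The process is stationary and ergodic with $\pi(x)=Pr[X(t)=x]$. The purchase vector $\boldsymbol A(t)=(A_1(t),\ldots,A_M(t))$ costs $c(\boldsymbol A(t),X(t))=\sum_{m=1}^Mx_m(t)A_m(t)$ and must lie in $\mathcal A(X(t))$, the set of integer vectors with $0\le A_m(t)\le\min[A_{m,max},s_m(t)]$ for all $m$ and $c(\boldsymbol A(t),X(t))\le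 c_{max}$, where $A_{m,max}$ and $c_{max}$ are finite constants. *Demand and pricing.* The demand state $Y(t)$ takes values in a finite or countably infinite set $\mathcal Y$ and is stationary and ergodic with $\pi(y)=Pr[Y(t)=y]$. Each slot the plant observes $\boldsymbol Q(t),X(t),Y(t)$ and then chooses $\boldsymbol A(t)$, offer variables $Z_k(t)\in\{0,1\}$ ($1$ means product $k$ is offered), and prices $P_k(t)\in\mathcal P_k$, where $\mathcal P_k$ is a compact set of nonnegative prices with maximum $P_{k,max}$. Consumers then generate an integer demand vector $\boldsymbol D(t)$ with $0\le D_k(t)\le D_{k,max}$ (finite integers); $D_k(t)$ depends on $P_k(t)$ and $Y(t)$, is conditionally i.i.d. over all slots with the same $P_k(t),Y(t)$ values (its conditional law given the past, current states and current decisions depends only on $P_k(t),Y(t)$), and has mean $F_k(p,y)=\mathbb{E}\{D_k(t)\mid P_k(t)=p,Y(t)=y\}$, continuous in $p\in\mathcal P_k$ for each $y\in\mathcal Y$. *Scheduling, queues, profit.* After seeing $\boldsymbol D(t)$ the plant chooses an integer vector $\tilde{\boldsymbol D}(t)$ of products actually sold with $0\le\tilde D_k(t)\le Z_k(t)D_k(t)$ for all $k$ and $\sum_{k=1}^K\beta_{mk}\tilde D_k(t)\le Q_m(t)$ for all $m$. The integer inventories evolve as $Q_m(t+1)=\max[Q_m(t)-\sum_{k=1}^K\beta_{mk}\tilde D_k(t),0]+A_m(t)$. The actual profit on slot $t$ is $\phi_{actual}(t)=-c(\boldsymbol A(t),X(t))+\sum_{k=1}^KZ_k(t)\tilde D_k(t)(P_k(t)-\alpha_k)$.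 *)

theory Defs
  imports "HOL-Probability.Probability"
begin

section \<open>Stationary and ergodic processes\<close>

definition path_law :: "'w measure \<Rightarrow> 's measure \<Rightarrow> (nat \<Rightarrow> 'w \<Rightarrow> 's) \<Rightarrow> (nat \<Rightarrow> 's) measure" where
  "path_law \<Omega> N W = distr \<Omega> (PiM UNIV (\<lambda>_. N)) (\<lambda>\<omega> t. W t \<omega>)"

definition stationary_process :: "'w measure \<Rightarrow> 's measure \<Rightarrow> (nat \<Rightarrow> 'w \<Rightarrow> 's) \<Rightarrow> bool" where
  "stationary_process \<Omega> N W \<longleftrightarrow>
     (\<forall>t. W t \<in> measurable \<Omega> N) \<and> path_law \<Omega> N (\<lambda>t. W (Suc t)) = path_law \<Omega> N W"

definition ergodic_process :: "'w measure \<Rightarrow> 's measure \<Rightarrow> (nat \<Rightarrow> 'w \<Rightarrow> 's) \<Rightarrow> bool" where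
  "ergodic_process \<Omega> N W \<longleftrightarrow>
     (\<forall>B \<in> sets (PiM UNIV (\<lambda>_::nat. N)).
        {w \<in> space (PiM UNIV (\<lambda>_. N)). (\<lambda>t. w (Suc t)) \<in> B} = B \<longrightarrow>
        measure (path_law \<Omega> N W) B \<in> {0, 1})"

text \<open>The marginal \<open>\<pi>(s)\<close>. For a stationary process the choice of slot 0 is immaterial.\<close>

definition state_prob :: "'w measure \<Rightarrow> (nat \<Rightarrow> 'w \<Rightarrow> 's) \<Rightarrow> 's \<Rightarrow> real" where
  "state_prob \<Omega> W s = measure \<Omega> {\<omega> \<in> space \<Omega>. W 0 \<omega> = s}"


section \<open>Static data of the plant\<close>

text \<open>Materials are indexed by \<open>'m\<close> and products by \<open>'k\<close>, both finite types.
  A supply state is a pair of per-unit prices and available amounts.\<close>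

type_synonym 'm supply_state = "('m \<Rightarrow> real) \<times> ('m \<Rightarrow> real)"

text \<open>The field \<open>demand_law k p y\<close> is the conditional law of the demand for product \<open>k\<close> in a slot
  with price \<open>p\<close> and demand state \<open>y\<close>.\<close>

record ('m, 'k, 'y) plant =
  usage :: "'m \<Rightarrow> 'k \<Rightarrow> nat"                       (* beta *)
  assembly_cost :: "'k \<Rightarrow> real"                    (* alpha *)
  supply_states :: "'m supply_state set"
  purchase_max :: "'m \<Rightarrow> real"
  cost_max :: real
  demand_states :: "'y set"
  price_set :: "'k \<Rightarrow> real set"
  demand_max :: "'k \<Rightarrow> nat"
  demand_law :: "'k \<Rightarrow> real \<Rightarrow> 'y \<Rightarrow> int pmf"

definition purchase_cost :: "('m::finite \<Rightarrow> int) \<Rightarrow> 'm supply_state \<Rightarrow> real" where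
  "purchase_cost a x = (\<Sum>m\<in>UNIV. fst x m * real_of_int (a m))"

definition purchase_set ::
    "('m::finite, 'k, 'y) plant \<Rightarrow> 'm supply_state \<Rightarrow> ('m \<Rightarrow> int) set" where
  "purchase_set pl x =
     {a. (\<forall>m. 0 \<le> a m \<and> real_of_int (a m) \<le> min (purchase_max pl m) (snd x m)) \<and>
         purchase_cost a x \<le> cost_max pl}"

definition mean_demand :: "('m, 'k, 'y) plant \<Rightarrow> 'k \<Rightarrow> real \<Rightarrow> 'y \<Rightarrow> real" where
  "mean_demand pl k p y = measure_pmf.expectation (demand_law pl k p y) real_of_int"

definition valid_plant :: "('m::finite, 'k::finite, 'y) plant \<Rightarrow> bool" where
  "valid_plant pl \<longleftrightarrow>
     (\<forall>k. 0 \<le> assembly_cost pl k) \<and>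
     countable (supply_states pl) \<and>
     (\<forall>x \<in> supply_states pl. \<forall>m. 0 \<le> fst x m \<and> 0 \<le> snd x m) \<and>
     countable (demand_states pl) \<and>
     (\<forall>k. compact (price_set pl k) \<and> price_set pl k \<noteq> {} \<and> (\<forall>p \<in> price_set pl k. 0 \<le> p)) \<and>
     (\<forall>k. \<forall>y \<in> demand_states pl. \<forall>p \<in> price_set pl k.
        set_pmf (demand_law pl k p y) \<subseteq> {0..int (demand_max pl k)}) \<and>
     (\<forall>k. \<forall>y \<in> demand_states pl. continuous_on (price_set pl k) (\<lambda>p. mean_demand pl k p y))"


section \<open>Operation of the plant\<close>

text \<open>All processes live on one probability space with sample points \<open>'w\<close>. The fields \<open>demanded\<close>
  and \<open>sold\<close> are the demand \<open>D(t)\<close> and the amounts actually sold.\<close>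

record ('w, 'm, 'k, 'y) run =
  supply_state :: "nat \<Rightarrow> 'w \<Rightarrow> 'm supply_state"          (* X *)
  demand_state :: "nat \<Rightarrow> 'w \<Rightarrow> 'y"                (* Y *)
  inventory :: "nat \<Rightarrow> 'w \<Rightarrow> 'm \<Rightarrow> int"             (* Q *)
  purchase :: "nat \<Rightarrow> 'w \<Rightarrow> 'm \<Rightarrow> int"              (* A *)
  offer :: "nat \<Rightarrow> 'w \<Rightarrow> 'k \<Rightarrow> int"                 (* Z *)
  price :: "nat \<Rightarrow> 'w \<Rightarrow> 'k \<Rightarrow> real"                (* P *)
  demanded :: "nat \<Rightarrow> 'w \<Rightarrow> 'k \<Rightarrow> int"
  sold :: "nat \<Rightarrow> 'w \<Rightarrow> 'k \<Rightarrow> int"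

definition material_used ::
    "('m, 'k::finite, 'y) plant \<Rightarrow> ('w, 'm, 'k, 'y) run \<Rightarrow> nat \<Rightarrow> 'w \<Rightarrow> 'm \<Rightarrow> int" where
  "material_used pl R t \<omega> m = (\<Sum>k\<in>UNIV. int (usage pl m k) * sold R t \<omega> k)"

definition actual_profit ::
    "('m::finite, 'k::finite, 'y) plant \<Rightarrow> ('w, 'm, 'k, 'y) run \<Rightarrow> nat \<Rightarrow> 'w \<Rightarrow> real" where
  "actual_profit pl R t \<omega> =
     - purchase_cost (purchase R t \<omega>) (supply_state R t \<omega>) +
     (\<Sum>k\<in>UNIV. real_of_int (offer R t \<omega> k) * real_of_int (sold R t \<omega> k) *
                (price R t \<omega> k - assembly_cost pl k))"

definition events_of :: "'w measure \<Rightarrow> 's measure \<Rightarrow> ('w \<Rightarrow> 's) \<Rightarrow> 'w set set" where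
  "events_of \<Omega> N f = {f -` B \<inter> space \<Omega> | B. B \<in> sets N}"

text \<open>The information available just before the demand of slot \<open>t\<close> is generated: the past together
  with the states, the queues and the decisions of slot \<open>t\<close>.\<close>

definition pre_demand_history ::
    "'w measure \<Rightarrow> ('w, 'm::finite, 'k::finite, 'y) run \<Rightarrow> nat \<Rightarrow> 'w measure" where
  "pre_demand_history \<Omega> R t = sigma (space \<Omega>)
     ((\<Union>s \<in> {..t}. events_of \<Omega> (count_space UNIV) (supply_state R s)
                  \<union> events_of \<Omega> (count_space UNIV) (demand_state R s)
                  \<union> events_of \<Omega> (count_space UNIV) (inventory R s)
                  \<union> events_of \<Omega> (count_space UNIV) (purchase R s)
                  \<union> events_of \<Omega> (count_space UNIV) (offer R s)
                  \<union> (\<Union>k. events_of \<Omega> borel (\<lambda>\<omega>. price R s \<omega> k)))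
      \<union> (\<Union>s \<in> {..<t}. events_of \<Omega> (count_space UNIV) (demanded R s)
                    \<union> events_of \<Omega> (count_space UNIV) (sold R s)))"

text \<open>A control algorithm enters only through the processes it produces, so quantifying over all
  runs covers every (possibly randomized, history dependent) rule. The assumption \<open>demand_law\<close>
  makes demand depend on the algorithm solely through the current price.\<close>

locale controlled_plant = prob_space \<Omega>
  for \<Omega> :: "'w measure" +
  fixes pl :: "('m::finite, 'k::finite, 'y) plant"
    and R :: "('w, 'm, 'k, 'y) run"
  assumes plant: "valid_plant pl"
    and supply_stationary: "stationary_process \<Omega> (count_space (supply_states pl)) (supply_state R)"
    and supply_ergodic: "ergodic_process \<Omega> (count_space (supply_states pl)) (supply_state R)"
    and demand_stationary: "stationary_process \<Omega> (count_space (demand_states pl)) (demand_state R)"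
    and demand_ergodic: "ergodic_process \<Omega> (count_space (demand_states pl)) (demand_state R)"
    and inventory_measurable: "\<And>t. inventory R t \<in> measurable \<Omega> (count_space UNIV)"
    and purchase_measurable: "\<And>t. purchase R t \<in> measurable \<Omega> (count_space UNIV)"
    and offer_measurable: "\<And>t. offer R t \<in> measurable \<Omega> (count_space UNIV)"
    and price_measurable: "\<And>t k. (\<lambda>\<omega>. price R t \<omega> k) \<in> borel_measurable \<Omega>"
    and demanded_measurable: "\<And>t. demanded R t \<in> measurable \<Omega> (count_space UNIV)"
    and sold_measurable: "\<And>t. sold R t \<in> measurable \<Omega> (count_space UNIV)"
    and purchase_option: "\<And>t \<omega>. \<omega> \<in> space \<Omega> \<Longrightarrow> purchase R t \<omega> \<in> purchase_set pl (supply_state R t \<omega>)"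
    and offer_option: "\<And>t \<omega> k. \<omega> \<in> space \<Omega> \<Longrightarrow> offer R t \<omega> k \<in> {0, 1}"
    and price_option: "\<And>t \<omega> k. \<omega> \<in> space \<Omega> \<Longrightarrow> price R t \<omega> k \<in> price_set pl k"
    and demanded_range:
      "\<And>t \<omega> k. \<omega> \<in> space \<Omega> \<Longrightarrow> demanded R t \<omega> k \<in> {0..int (demand_max pl k)}"
    and demand_law: "\<And>t k d. AE \<omega> in \<Omega>.
      real_cond_exp \<Omega> (pre_demand_history \<Omega> R t)
        (indicator {\<omega> \<in> space \<Omega>. demanded R t \<omega> k = d}) \<omega>
      = pmf (demand_law pl k (price R t \<omega> k) (demand_state R t \<omega>)) d"
    and sold_range: "\<And>t \<omega> k. \<omega> \<in> space \<Omega> \<Longrightarrow>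
      0 \<le> sold R t \<omega> k \<and> sold R t \<omega> k \<le> offer R t \<omega> k * demanded R t \<omega> k"
    and sold_supplied: "\<And>t \<omega> m. \<omega> \<in> space \<Omega> \<Longrightarrow> material_used pl R t \<omega> m \<le> inventory R t \<omega> m"
    and inventory_update: "\<And>t \<omega> m. \<omega> \<in> space \<Omega> \<Longrightarrow>
      inventory R (Suc t) \<omega> m =
        max (inventory R t \<omega> m - material_used pl R t \<omega> m) 0 + purchase R t \<omega> m"


section \<open>The optimization problem\<close>

text \<open>Values of the pair \<open>(Z, P)\<close> of an offer vector and a price vector; the constraints
  \<open>Z k \<in> {0, 1}\<close> and \<open>P k \<in> price_set pl k\<close> are built into the underlying space.\<close>

definition offer_price_space :: "('m, 'k, 'y) plant \<Rightarrow> (('k \<Rightarrow> int) \<times> ('k \<Rightarrow> real)) measure" where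
  "offer_price_space pl =
     PiM UNIV (\<lambda>_. count_space {0, 1}) \<Otimes>\<^sub>M PiM UNIV (\<lambda>k. restrict_space borel (price_set pl k))"

text \<open>\<open>program_value pl \<pi>X \<pi>Y \<phi>\<close> says that some feasible point of the optimization problem has
  objective value \<open>\<phi>\<close>. Here \<open>\<nu> y\<close> is the conditional distribution of \<open>(Z, P)\<close> given demand
  state \<open>y\<close>.\<close>

definition program_value ::
    "('m::finite, 'k::finite, 'y) plant \<Rightarrow> ('m supply_state \<Rightarrow> real) \<Rightarrow> ('y \<Rightarrow> real) \<Rightarrow> real \<Rightarrow> bool" where
  "program_value pl \<pi>X \<pi>Y \<phi> \<longleftrightarrow>
     (\<exists>(c :: real) (r :: real) (\<theta> :: ('m \<Rightarrow> int) \<Rightarrow> 'm supply_state \<Rightarrow> real)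
       (a_hat :: 'm \<Rightarrow> real) (\<mu>_hat :: 'm \<Rightarrow> real)
       (\<nu> :: 'y \<Rightarrow> (('k \<Rightarrow> int) \<times> ('k \<Rightarrow> real)) measure).
        \<phi> = - c + r \<and>
        (\<forall>m. a_hat m \<ge> \<mu>_hat m) \<and>
        c = (\<Sum>\<^sub>\<infinity>x\<in>supply_states pl.
               \<pi>X x * (\<Sum>a\<in>purchase_set pl x. \<theta> a x * purchase_cost a x)) \<and>
        r = (\<Sum>\<^sub>\<infinity>y\<in>demand_states pl. \<pi>Y y * (\<Sum>k\<in>UNIV.
               (\<integral>zp. real_of_int (fst zp k) * (snd zp k - assembly_cost pl k)
                      * mean_demand pl k (snd zp k) y \<partial>\<nu> y))) \<and>
        (\<forall>m. a_hat m = (\<Sum>\<^sub>\<infinity>x\<in>supply_states pl.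
               \<pi>X x * (\<Sum>a\<in>purchase_set pl x. \<theta> a x * real_of_int (a m)))) \<and>
        (\<forall>m. \<mu>_hat m = (\<Sum>\<^sub>\<infinity>y\<in>demand_states pl. \<pi>Y y * (\<Sum>k\<in>UNIV. real (usage pl m k) *
               (\<integral>zp. real_of_int (fst zp k) * mean_demand pl k (snd zp k) y \<partial>\<nu> y)))) \<and>
        (\<forall>x\<in>supply_states pl. \<forall>a\<in>purchase_set pl x. 0 \<le> \<theta> a x \<and> \<theta> a x \<le> 1) \<and>
        (\<forall>x\<in>supply_states pl. (\<Sum>a\<in>purchase_set pl x. \<theta> a x) = 1) \<and>
        (\<forall>y\<in>demand_states pl. prob_space (\<nu> y) \<and> sets (\<nu> y) = sets (offer_price_space pl)))"

definition is_program_max ::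
    "('m::finite, 'k::finite, 'y) plant \<Rightarrow> ('m supply_state \<Rightarrow> real) \<Rightarrow> ('y \<Rightarrow> real) \<Rightarrow> real \<Rightarrow> bool" where
  "is_program_max pl \<pi>X \<pi>Y \<phi> \<longleftrightarrow>
     program_value pl \<pi>X \<pi>Y \<phi> \<and> (\<forall>\<psi>. program_value pl \<pi>X \<pi>Y \<psi> \<longrightarrow> \<psi> \<le> \<phi>)"

end

theory Submission
  imports Defs
begin

text \<open>
  Each slot produces a payoff vector with one coordinate for profit and one coordinate per material:
  purchasing contributes minus the cost and the amounts bought, selling contributes the revenue and
  the amounts used. In expectation the purchasing vector of a slot ranges over a set \<open>U\<close> and the
  selling vector over a set \<open>V\<close>, and the optimization problem is exactly the maximization of the total
  profit coordinate over pairs \<open>(u, v) \<in> U \<times> V\<close> for which \<open>u\<close> supplies every material that \<open>v\<close> uses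
  (\<open>program_value_imp_selections\<close>, \<open>selections_imp_program_value\<close>).

  Both sets have the form \<open>{\<Sum>i. \<pi> i *\<^sub>R v i | v i \<in> C i}\<close>, where \<open>i\<close> ranges over the countably many
  states and \<open>C i\<close> is the convex hull of the payoffs available in state \<open>i\<close>. The \<open>C i\<close> are compact and
  uniformly bounded, so \<open>U\<close> and \<open>V\<close> are compact by Tychonoff's theorem
  (\<open>compact_weighted_selections\<close>), and convex. Compactness makes the problem attain its maximum.

  The expected payoff of a slot lies in \<open>U\<close> and \<open>V\<close> because no linear functional can separate it from
  them (\<open>expectation_vector_mem_weighted_selections\<close>). For sales this is the point where the control
  algorithm enters: a linear functional assigns a reward to each unit sold, the amount sold lies
  between zero and the demand on offer, hence the reward is at most the one obtained by serving all
  demand for the products with positive unit reward and none for the others. Demand depends on the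
  algorithm through the price alone, so its conditional mean given price and state may replace it,
  and the result is the payoff of an admissible offer and price decision
  (\<open>expectation_inner_sale_le\<close>).

  By convexity the time averages also lie in \<open>U\<close> and \<open>V\<close>. Inventories are nonnegative, so up to
  slot \<open>n\<close> the materials used exceed those bought by at most the initial inventory, and the averaged
  pair violates the material constraints by at most \<open>E Q\<^sub>m(0) / n\<close>. Every limit point of the averages
  is therefore feasible, which bounds the limit superior (\<open>limsup_almost_feasible_le\<close>).
\<close>

section \<open>Convex sets and their support functions\<close>

text \<open>Otherwise a hyperplane strictly separates \<open>x\<close> from \<open>C\<close>, and its normal, suitably oriented, is a
  direction in which \<open>x\<close> beats every point of \<open>C\<close>.\<close>

lemma mem_convex_if_supported:
  fixes C :: "'a::euclidean_space set"
  assumes "convex C" "closed C" "\<And>l. \<exists>u\<in>C. l \<bullet> x \<le> l \<bullet> u"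
  shows "x \<in> C"
proof (rule ccontr)
  assume "x \<notin> C"
  then obtain a b where "a \<bullet> x < b" "\<forall>u\<in>C. a \<bullet> u > b"
    using separating_hyperplane_closed_point[OF assms(1,2)] by blast
  moreover obtain u where "u \<in> C" "(- a) \<bullet> x \<le> (- a) \<bullet> u"
    using assms(3) by blast
  ultimately show False
    by (metis inner_minus_left neg_le_iff_le order_less_trans linorder_not_less)
qed

lemma maximal_inner_attained:
  fixes C :: "'a::euclidean_space set"
  assumes "compact C" "C \<noteq> {}"
  shows "\<exists>u\<in>C. \<forall>v\<in>C. l \<bullet> v \<le> l \<bullet> u"
  using continuous_attains_sup[OF assms, of "\<lambda>u. l \<bullet> u"] by (simp add: continuous_intros)

lemma maximal_selection:
  assumes "\<And>i. i \<in> I \<Longrightarrow> compact (C i)" "\<And>i. i \<in> I \<Longrightarrow> (0 :: 'b::euclidean_space) \<in> C i"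
  obtains v where "\<forall>i\<in>I. v i \<in> C i" "\<And>i u. i \<in> I \<Longrightarrow> u \<in> C i \<Longrightarrow> l \<bullet> u \<le> l \<bullet> v i"
proof -
  have "\<forall>i\<in>I. \<exists>v\<in>C i. \<forall>u\<in>C i. l \<bullet> u \<le> l \<bullet> v"
    using assms maximal_inner_attained by blast
  then show thesis
    using that by metis
qed

text \<open>The empty average is \<open>0\<close>, because \<open>1 / 0 = 0\<close>; this is where \<open>0 \<in> U\<close> enters.\<close>

lemma time_average_mem:
  fixes U :: "'a::real_vector set"
  assumes "convex U" "0 \<in> U" "\<And>t. f t \<in> U"
  shows "(1 / real n) *\<^sub>R (\<Sum>t<n. f t) \<in> U"
proof (cases "n = 0")
  case False
  have "(\<Sum>t<n. (1 / real n) *\<^sub>R f t) \<in> U"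
    using False assms by (intro convex_sum) auto
  then show ?thesis
    by (simp add: scaleR_sum_right)
qed (use assms in simp)

section \<open>Weighted sums of selections from a family of sets\<close>

text \<open>With weights a probability distribution, these are the possible means of a random vector
  whose conditional mean in state \<open>i\<close> is some point of \<open>C i\<close>.\<close>

definition weighted_selections ::
    "('i \<Rightarrow> real) \<Rightarrow> 'i set \<Rightarrow> ('i \<Rightarrow> 'a::real_normed_vector set) \<Rightarrow> 'a set" where
  "weighted_selections w I C = {\<Sum>\<^sub>\<infinity>i\<in>I. w i *\<^sub>R v i | v. \<forall>i\<in>I. v i \<in> C i}"

lemma weighted_selections_cong:
  fixes C :: "'i \<Rightarrow> 'a::real_normed_vector set"
  assumes "\<And>i. i \<in> I \<Longrightarrow> w i = w' i"
  shows "weighted_selections w I C = weighted_selections w' I C"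
proof -
  have "(\<Sum>\<^sub>\<infinity>i\<in>I. w i *\<^sub>R v i) = (\<Sum>\<^sub>\<infinity>i\<in>I. w' i *\<^sub>R v i)" for v :: "'i \<Rightarrow> 'a"
    using assms by (intro infsum_cong) simp
  then show ?thesis
    by (simp add: weighted_selections_def)
qed

lemma weighted_selectionsI:
  "\<forall>i\<in>I. v i \<in> C i \<Longrightarrow> (\<Sum>\<^sub>\<infinity>i\<in>I. w i *\<^sub>R v i) \<in> weighted_selections w I C"
  by (auto simp: weighted_selections_def)

locale bounded_family =
  fixes w :: "'i \<Rightarrow> real" and I :: "'i set" and C :: "'i \<Rightarrow> 'a::euclidean_space set" and B :: real
  assumes weight_nonneg: "\<And>i. i \<in> I \<Longrightarrow> 0 \<le> w i"
    and weight_summable: "w summable_on I"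
    and norm_bound: "\<And>i u. i \<in> I \<Longrightarrow> u \<in> C i \<Longrightarrow> norm u \<le> B"
begin

lemma selection_norm_bound:
  "i \<in> I \<Longrightarrow> v i \<in> C i \<Longrightarrow> norm (w i *\<^sub>R v i) \<le> w i * B"
  using weight_nonneg norm_bound by (simp add: mult_left_mono)

lemma selection_summable:
  assumes "\<forall>i\<in>I. v i \<in> C i"
  shows "(\<lambda>i. w i *\<^sub>R v i) summable_on I"
proof -
  have "(\<lambda>i. w i * B) summable_on I"
    using weight_summable by (rule summable_on_cmult_left)
  then have "(\<lambda>i. norm (w i *\<^sub>R v i)) summable_on I"
    by (rule summable_on_comparison_test) (use assms selection_norm_bound in auto)
  then show ?thesis
    by (rule abs_summable_summable)
qed

lemma linear_weighted_selection:
  fixes h :: "'a \<Rightarrow> real"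
  assumes "\<forall>i\<in>I. v i \<in> C i" "bounded_linear h"
  shows "h (\<Sum>\<^sub>\<infinity>i\<in>I. w i *\<^sub>R v i) = (\<Sum>\<^sub>\<infinity>i\<in>I. w i * h (v i))"
proof -
  interpret h: bounded_linear h by fact
  show ?thesis
    using has_sum_bounded_linear[OF assms(2) has_sum_infsum[OF selection_summable[OF assms(1)]]]
    by (simp add: infsumI o_def h.scaleR)
qed

text \<open>The selections form a compact set in the product topology by Tychonoff's theorem, and the
  weighted sum is continuous on it as a uniform limit of finite sums (Weierstrass M-test).\<close>

lemma compact_weighted_selections:
  assumes "\<And>i. i \<in> I \<Longrightarrow> compact (C i)"
  shows "compact (weighted_selections w I C)"
proof -
  \<comment> \<open>The product topology lives on total functions, so the coordinates outside \<open>I\<close> are pinned to \<open>0\<close>.\<close>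
  define K where "K = (\<Pi>\<^sub>E i\<in>UNIV. if i \<in> I then C i else {0})"
  have "compact K"
    unfolding K_def compactin_euclidean_iff[symmetric] euclidean_product_topology[symmetric]
    using assms by (subst compactin_PiE) auto
  have "uniform_limit K (\<lambda>F v. \<Sum>i\<in>F. w i *\<^sub>R v i) (\<lambda>v. \<Sum>\<^sub>\<infinity>i\<in>I. w i *\<^sub>R v i)
          (finite_subsets_at_top I)"
  proof (rule Weierstrass_m_test_general)
    show "(\<lambda>i. w i * B) summable_on I"
      using weight_summable by (rule summable_on_cmult_left)
    show "norm (w i *\<^sub>R v i) \<le> w i * B" if "i \<in> I" "v \<in> K" for i v
      using that selection_norm_bound[of i v] by (auto simp: K_def PiE_def Pi_def split: if_splits)
  qed
  moreover have "continuous_on K (\<lambda>v. \<Sum>i\<in>F. w i *\<^sub>R v i)" for F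
    by (intro continuous_intros continuous_on_product_coordinates[THEN continuous_on_subset]) auto
  ultimately have "continuous_on K (\<lambda>v. \<Sum>\<^sub>\<infinity>i\<in>I. w i *\<^sub>R v i)"
    by (intro uniform_limit_theorem[where F = "finite_subsets_at_top I"]) auto
  then have "compact ((\<lambda>v. \<Sum>\<^sub>\<infinity>i\<in>I. w i *\<^sub>R v i) ` K)"
    using \<open>compact K\<close> by (rule compact_continuous_image)
  also have "(\<lambda>v. \<Sum>\<^sub>\<infinity>i\<in>I. w i *\<^sub>R v i) ` K = weighted_selections w I C"
  proof (intro equalityI subsetI)
    fix x assume "x \<in> weighted_selections w I C"
    then obtain v where v: "\<forall>i\<in>I. v i \<in> C i" "x = (\<Sum>\<^sub>\<infinity>i\<in>I. w i *\<^sub>R v i)"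
      by (auto simp: weighted_selections_def)
    define v' where "v' = (\<lambda>i. if i \<in> I then v i else 0)"
    have "v' \<in> K"
      using v(1) by (auto simp: K_def v'_def)
    moreover have "x = (\<Sum>\<^sub>\<infinity>i\<in>I. w i *\<^sub>R v' i)"
      unfolding v(2) by (rule infsum_cong) (simp add: v'_def)
    ultimately show "x \<in> (\<lambda>v. \<Sum>\<^sub>\<infinity>i\<in>I. w i *\<^sub>R v i) ` K"
      by blast
  next
    fix x assume "x \<in> (\<lambda>v. \<Sum>\<^sub>\<infinity>i\<in>I. w i *\<^sub>R v i) ` K"
    then obtain v where "v \<in> K" "x = (\<Sum>\<^sub>\<infinity>i\<in>I. w i *\<^sub>R v i)"
      by blast
    moreover from \<open>v \<in> K\<close> have "\<forall>i\<in>I. v i \<in> C i"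
      by (auto simp: K_def PiE_def Pi_def split: if_splits)
    ultimately show "x \<in> weighted_selections w I C"
      by (auto simp: weighted_selections_def)
  qed
  finally show ?thesis .
qed

lemma convex_weighted_selections:
  assumes "\<And>i. i \<in> I \<Longrightarrow> convex (C i)"
  shows "convex (weighted_selections w I C)"
proof (rule convexI)
  fix x y and a b :: real
  assume x: "x \<in> weighted_selections w I C" and y: "y \<in> weighted_selections w I C"
    and ab: "0 \<le> a" "0 \<le> b" "a + b = 1"
  from x y obtain v v' where v: "\<forall>i\<in>I. v i \<in> C i" "x = (\<Sum>\<^sub>\<infinity>i\<in>I. w i *\<^sub>R v i)"
    and v': "\<forall>i\<in>I. v' i \<in> C i" "y = (\<Sum>\<^sub>\<infinity>i\<in>I. w i *\<^sub>R v' i)"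
    by (auto simp: weighted_selections_def)
  note s = selection_summable[OF v(1)] selection_summable[OF v'(1)]
  have "a *\<^sub>R x + b *\<^sub>R y = (\<Sum>\<^sub>\<infinity>i\<in>I. a *\<^sub>R w i *\<^sub>R v i + b *\<^sub>R w i *\<^sub>R v' i)"
    unfolding v v' infsum_scaleR_right[symmetric]
    using s by (intro infsum_add[symmetric] summable_on_scaleR_right)
  also have "\<dots> = (\<Sum>\<^sub>\<infinity>i\<in>I. w i *\<^sub>R (a *\<^sub>R v i + b *\<^sub>R v' i))"
    by (simp add: algebra_simps)
  finally show "a *\<^sub>R x + b *\<^sub>R y \<in> weighted_selections w I C"
    using v(1) v'(1) ab assms
    by (auto simp: weighted_selections_def convex_def intro!: exI[of _ "\<lambda>i. a *\<^sub>R v i + b *\<^sub>R v' i"])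
qed

end

section \<open>Expectations driven by a countable state\<close>

context prob_space
begin

text \<open>The law of a countable state has density \<open>w\<close> with respect to counting measure.\<close>

lemma expectation_countable_state:
  fixes g :: "'i \<Rightarrow> real"
  assumes W[measurable]: "W \<in> measurable M (count_space I)" and I: "countable I"
    and bound: "\<And>i. i \<in> I \<Longrightarrow> \<bar>g i\<bar> \<le> B"
  defines "w \<equiv> \<lambda>i. prob {\<omega> \<in> space M. W \<omega> = i}"
  shows "w summable_on I"
    and "integrable M (\<lambda>\<omega>. g (W \<omega>))"
    and "expectation (\<lambda>\<omega>. g (W \<omega>)) = (\<Sum>\<^sub>\<infinity>i\<in>I. w i * g i)"
proof -
  have law: "distr M (count_space I) W = density (count_space I) (\<lambda>i. ennreal (w i))"
  proof (rule measure_eqI_countable[OF _ _ I])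
    fix i assume i: "i \<in> I"
    then have "emeasure (distr M (count_space I) W) {i} = emeasure M {\<omega> \<in> space M. W \<omega> = i}"
      by (subst emeasure_distr) (auto intro!: arg_cong[where f = "emeasure M"])
    with i show "emeasure (distr M (count_space I) W) {i}
        = emeasure (density (count_space I) (\<lambda>i. ennreal (w i))) {i}"
      by (simp add: w_def emeasure_eq_measure emeasure_density nn_integral_count_space_indicator
            one_ennreal_def[symmetric])
  qed auto
  have int: "integrable M (\<lambda>\<omega>. h (W \<omega>)) \<and> (\<lambda>i. norm (w i * h i)) summable_on I
      \<and> expectation (\<lambda>\<omega>. h (W \<omega>)) = (\<Sum>\<^sub>\<infinity>i\<in>I. w i * h i)"
    if h: "\<And>i. i \<in> I \<Longrightarrow> \<bar>h i\<bar> \<le> D" for h :: "'i \<Rightarrow> real" and D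
  proof -
    have i1: "integrable M (\<lambda>\<omega>. h (W \<omega>))"
      using h measurable_space[OF W] measurable_compose[OF W, of h borel]
      by (intro integrable_const_bound[where B = D]) auto
    then have "integrable (distr M (count_space I) W) h"
      by (subst integrable_distr_eq) auto
    then have "integrable (count_space I) (\<lambda>i. w i * h i)"
      unfolding law by (subst (asm) integrable_density) (auto simp: w_def)
    then have i2: "Infinite_Set_Sum.abs_summable_on (\<lambda>i. w i * h i) I"
      by (simp add: Infinite_Set_Sum.abs_summable_on_def)
    have "expectation (\<lambda>\<omega>. h (W \<omega>)) = integral\<^sup>L (distr M (count_space I) W) h"
      by (subst integral_distr) auto
    also have "\<dots> = infsetsum (\<lambda>i. w i * h i) I"
      unfolding law infsetsum_def by (subst integral_density) (auto simp: w_def)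
    also have "\<dots> = (\<Sum>\<^sub>\<infinity>i\<in>I. w i * h i)"
      using i2 by (rule infsetsum_infsum)
    finally show ?thesis
      using i1 abs_summable_equivalent[THEN iffD2, OF i2] by blast
  qed
  have "(\<lambda>i. norm (w i * 1)) summable_on I"
    by (rule int[THEN conjunct2, THEN conjunct1, of _ 1]) simp
  then show "w summable_on I"
    using abs_summable_summable[of "\<lambda>i. w i * 1"] by simp
  show "integrable M (\<lambda>\<omega>. g (W \<omega>))" "expectation (\<lambda>\<omega>. g (W \<omega>)) = (\<Sum>\<^sub>\<infinity>i\<in>I. w i * g i)"
    using int[of g B, OF bound] by blast+
qed

lemma integrable_inner:
  fixes G :: "'a \<Rightarrow> real ^ 'n"
  assumes "\<And>j. integrable M (\<lambda>\<omega>. G \<omega> $ j)"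
  shows "integrable M (\<lambda>\<omega>. l \<bullet> G \<omega>)"
  using assms by (simp add: inner_vec_def)

lemma integrable_inner_selection:
  assumes "W \<in> measurable M (count_space I)" "countable I"
    and "\<And>i. i \<in> I \<Longrightarrow> norm (v i) \<le> (B :: real)"
  shows "integrable M (\<lambda>\<omega>. l \<bullet> v (W \<omega>))"
proof (rule expectation_countable_state(2)[OF assms(1,2)])
  fix i assume "i \<in> I"
  then show "\<bar>l \<bullet> v i\<bar> \<le> norm l * B"
    using assms(3) by (meson Cauchy_Schwarz_ineq2 mult_left_mono norm_ge_zero order_trans)
qed

text \<open>This is the tool that puts expected payoffs into the feasible set. It replaces a disintegration
  of \<open>G\<close> over the state by one scalar inequality per direction: the set of weighted selections is
  compact and convex, so it contains every point that it dominates in each direction.\<close>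

lemma expectation_vector_mem_weighted_selections:
  fixes W :: "'a \<Rightarrow> 'i" and G :: "'a \<Rightarrow> real ^ 'n" and C :: "'i \<Rightarrow> (real ^ 'n) set"
  assumes W: "W \<in> measurable M (count_space I)" and I: "countable I"
    and C: "\<And>i. i \<in> I \<Longrightarrow> compact (C i)" "\<And>i. i \<in> I \<Longrightarrow> convex (C i)"
    and bound: "\<And>i u. i \<in> I \<Longrightarrow> u \<in> C i \<Longrightarrow> norm u \<le> B"
    and G: "\<And>j. integrable M (\<lambda>\<omega>. G \<omega> $ j)"
    and supp: "\<And>l. \<exists>v. (\<forall>i\<in>I. v i \<in> C i) \<and> expectation (\<lambda>\<omega>. l \<bullet> G \<omega>) \<le> expectation (\<lambda>\<omega>. l \<bullet> v (W \<omega>))"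
  defines "w \<equiv> \<lambda>i. prob {\<omega> \<in> space M. W \<omega> = i}"
  shows "(\<chi> j. expectation (\<lambda>\<omega>. G \<omega> $ j)) \<in> weighted_selections w I C"
proof -
  interpret bounded_family w I C B
    using bound expectation_countable_state(1)[OF W I, of "\<lambda>_. 0" 0]
    by unfold_locales (auto simp: w_def)
  show ?thesis
  proof (rule mem_convex_if_supported[OF convex_weighted_selections[OF C(2)]
        compact_imp_closed[OF compact_weighted_selections[OF C(1)]]])
    fix l
    from supp[of l] obtain v where v: "\<forall>i\<in>I. v i \<in> C i"
      "expectation (\<lambda>\<omega>. l \<bullet> G \<omega>) \<le> expectation (\<lambda>\<omega>. l \<bullet> v (W \<omega>))"
      by blast
    have "l \<bullet> (\<chi> j. expectation (\<lambda>\<omega>. G \<omega> $ j)) = expectation (\<lambda>\<omega>. l \<bullet> G \<omega>)"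
      by (simp add: inner_vec_def G integral_mult_right)
    also note v(2)
    also have "expectation (\<lambda>\<omega>. l \<bullet> v (W \<omega>)) = (\<Sum>\<^sub>\<infinity>i\<in>I. w i * (l \<bullet> v i))"
      unfolding w_def
    proof (rule expectation_countable_state(3)[OF W I])
      show "\<bar>l \<bullet> v i\<bar> \<le> norm l * B" if "i \<in> I" for i
        using that v(1) bound by (meson Cauchy_Schwarz_ineq2 mult_left_mono norm_ge_zero order_trans)
    qed
    also have "\<dots> = l \<bullet> (\<Sum>\<^sub>\<infinity>i\<in>I. w i *\<^sub>R v i)"
      by (rule linear_weighted_selection[OF v(1) bounded_linear_inner_right, symmetric])
    finally show "\<exists>u\<in>weighted_selections w I C. l \<bullet> (\<chi> j. expectation (\<lambda>\<omega>. G \<omega> $ j)) \<le> l \<bullet> u"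
      using v(1) by (auto simp: weighted_selections_def)
  qed simp_all
qed

end

text \<open>The marginals of slots \<open>t\<close> and \<open>t + 1\<close> are coordinate \<open>t\<close> of the path laws of the process and of
  its shift, which stationarity identifies.\<close>

lemma (in prob_space) stationary_marginal:
  assumes "stationary_process M (count_space S) W" "s \<in> S"
  shows "prob {\<omega> \<in> space M. W t \<omega> = s} = state_prob M W s"
proof -
  let ?N = "count_space S"
  have W: "W t \<in> measurable M ?N" for t
    using assms(1) by (simp add: stationary_process_def)
  have law: "measure (path_law M ?N V) {w \<in> space (PiM UNIV (\<lambda>_. ?N)). w t = s} = prob {\<omega> \<in> space M. V t \<omega> = s}"
    if V: "\<And>t. V t \<in> measurable M ?N" for V :: "nat \<Rightarrow> 'a \<Rightarrow> 'b" and t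
  proof -
    have m: "(\<lambda>\<omega> t. V t \<omega>) \<in> measurable M (PiM UNIV (\<lambda>_. ?N))"
      by (rule measurable_abs_UNIV) (rule V)
    have "(\<lambda>w. w t) -` {s} \<inter> space (PiM UNIV (\<lambda>_. ?N)) \<in> sets (PiM UNIV (\<lambda>_. ?N))"
      by (rule measurable_sets[OF measurable_component_singleton]) (use assms(2) in auto)
    also have "(\<lambda>w. w t) -` {s} \<inter> space (PiM UNIV (\<lambda>_. ?N)) = {w \<in> space (PiM UNIV (\<lambda>_. ?N)). w t = s}"
      by auto
    finally have "measure (path_law M ?N V) {w \<in> space (PiM UNIV (\<lambda>_. ?N)). w t = s}
        = prob ((\<lambda>\<omega> t. V t \<omega>) -` {w \<in> space (PiM UNIV (\<lambda>_. ?N)). w t = s} \<inter> space M)"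
      unfolding path_law_def by (rule measure_distr[OF m])
    also have "(\<lambda>\<omega> t. V t \<omega>) -` {w \<in> space (PiM UNIV (\<lambda>_. ?N)). w t = s} \<inter> space M
        = {\<omega> \<in> space M. V t \<omega> = s}"
      using measurable_space[OF m] by auto
    finally show ?thesis .
  qed
  show ?thesis
  proof (induction t)
    case 0
    show ?case
      by (simp add: state_prob_def)
  next
    case (Suc t)
    have "prob {\<omega> \<in> space M. W (Suc t) \<omega> = s} = prob {\<omega> \<in> space M. W t \<omega> = s}"
      using law[of "\<lambda>t. W (Suc t)" t] law[of W t] W assms(1) by (simp add: stationary_process_def)
    with Suc show ?case
      by simp
  qed
qed

section \<open>Payoff regions of supply and demand states\<close>

text \<open>The coordinate \<open>None\<close> carries profit and \<open>Some m\<close> carries material \<open>m\<close>; index type \<open>'m option\<close>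
  keeps both in one Euclidean space.\<close>

definition supply_vector ::
    "'m::finite supply_state \<Rightarrow> ('m \<Rightarrow> int) \<Rightarrow> real ^ 'm option" where
  "supply_vector x a =
     (\<chi> j. case j of None \<Rightarrow> - purchase_cost a x | Some m \<Rightarrow> real_of_int (a m))"

definition unit_sale_vector ::
    "('m::finite, 'k, 'y) plant \<Rightarrow> 'k \<Rightarrow> real \<Rightarrow> real ^ 'm option" where
  "unit_sale_vector pl k p =
     (\<chi> j. case j of None \<Rightarrow> p - assembly_cost pl k | Some m \<Rightarrow> real (usage pl m k))"

definition demand_vector ::
    "('m::finite, 'k::finite, 'y) plant \<Rightarrow> 'y \<Rightarrow> ('k \<Rightarrow> int) \<times> ('k \<Rightarrow> real) \<Rightarrow> real ^ 'm option" where
  "demand_vector pl y zp =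
     (\<Sum>k\<in>UNIV. (real_of_int (fst zp k) * mean_demand pl k (snd zp k) y)
                 *\<^sub>R unit_sale_vector pl k (snd zp k))"

definition supply_region ::
    "('m::finite, 'k, 'y) plant \<Rightarrow> 'm supply_state \<Rightarrow> (real ^ 'm option) set" where
  "supply_region pl x = convex hull supply_vector x ` purchase_set pl x"

definition offer_prices :: "('m, 'k, 'y) plant \<Rightarrow> (('k \<Rightarrow> int) \<times> ('k \<Rightarrow> real)) set" where
  "offer_prices pl = {zp. \<forall>k. fst zp k \<in> {0, 1} \<and> snd zp k \<in> price_set pl k}"

text \<open>The hull stands for randomization over offers and prices within one demand state.\<close>

definition demand_region ::
    "('m::finite, 'k::finite, 'y) plant \<Rightarrow> 'y \<Rightarrow> (real ^ 'm option) set" where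
  "demand_region pl y = convex hull demand_vector pl y ` offer_prices pl"

lemma supply_vector_nth [simp]:
  "supply_vector x a $ None = - purchase_cost a x"
  "supply_vector x a $ Some m = real_of_int (a m)"
  by (simp_all add: supply_vector_def)

lemma unit_sale_vector_nth [simp]:
  "unit_sale_vector pl k p $ None = p - assembly_cost pl k"
  "unit_sale_vector pl k p $ Some m = real (usage pl m k)"
  by (simp_all add: unit_sale_vector_def)

lemma demand_vector_nth:
  "demand_vector pl y zp $ j = (\<Sum>k\<in>UNIV. real_of_int (fst zp k) * mean_demand pl k (snd zp k) y
     * unit_sale_vector pl k (snd zp k) $ j)"
  by (simp add: demand_vector_def)

lemma inj_supply_vector: "inj (supply_vector x)"
proof (rule injI, rule ext)
  fix a b m assume "supply_vector x a = supply_vector x b"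
  then have "supply_vector x a $ Some m = supply_vector x b $ Some m"
    by simp
  then show "a m = b m"
    by simp
qed

lemma finite_purchase_set: "finite (purchase_set pl x)"
proof (rule finite_subset)
  show "purchase_set pl x \<subseteq> (\<Pi>\<^sub>E m\<in>UNIV. {0..\<lfloor>purchase_max pl m\<rfloor>})"
    by (auto simp: purchase_set_def le_floor_iff)
qed (auto intro: finite_PiE)

lemma purchase_cost_nonneg:
  "valid_plant pl \<Longrightarrow> x \<in> supply_states pl \<Longrightarrow> a \<in> purchase_set pl x \<Longrightarrow> 0 \<le> purchase_cost a x"
  by (auto simp: valid_plant_def purchase_set_def purchase_cost_def intro!: sum_nonneg)

lemma compact_supply_region: "compact (supply_region pl x)"
  by (simp add: supply_region_def finite_purchase_set finite_imp_compact_convex_hull)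

lemma norm_supply_vector_le:
  assumes "valid_plant pl" "x \<in> supply_states pl" "a \<in> purchase_set pl x"
  shows "norm (supply_vector x a) \<le> cost_max pl + (\<Sum>m\<in>UNIV. purchase_max pl m)"
proof -
  have "norm (supply_vector x a) \<le> (\<Sum>j\<in>UNIV. \<bar>supply_vector x a $ j\<bar>)"
    by (rule norm_le_l1_cart)
  also have "\<dots> = \<bar>purchase_cost a x\<bar> + (\<Sum>m\<in>UNIV. \<bar>real_of_int (a m)\<bar>)"
    by (simp add: UNIV_option_conv sum.reindex)
  also have "\<dots> \<le> cost_max pl + (\<Sum>m\<in>UNIV. purchase_max pl m)"
    using assms purchase_cost_nonneg[OF assms]
    by (intro add_mono sum_mono) (auto simp: purchase_set_def)
  finally show ?thesis .
qed

lemma norm_supply_region_le: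
  assumes "valid_plant pl" "x \<in> supply_states pl" "u \<in> supply_region pl x"
  shows "norm u \<le> cost_max pl + (\<Sum>m\<in>UNIV. purchase_max pl m)"
proof -
  have "supply_region pl x \<subseteq> cball 0 (cost_max pl + (\<Sum>m\<in>UNIV. purchase_max pl m))"
    unfolding supply_region_def
    by (rule hull_minimal) (use norm_supply_vector_le[OF assms(1,2)] in auto)
  with assms(3) show ?thesis
    by auto
qed

text \<open>The coordinates of a supply vector determine the purchase, so weights on vectors and weights
  \<open>\<theta>\<close> on purchases are the same thing.\<close>

lemma supply_region_iff:
  "u \<in> supply_region pl x \<longleftrightarrow>
     (\<exists>\<theta>. (\<forall>a\<in>purchase_set pl x. 0 \<le> \<theta> a \<and> \<theta> a \<le> 1) \<and> (\<Sum>a\<in>purchase_set pl x. \<theta> a) = 1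
        \<and> u = (\<Sum>a\<in>purchase_set pl x. \<theta> a *\<^sub>R supply_vector x a))"
proof -
  let ?A = "purchase_set pl x"
  have inj: "inj_on (supply_vector x) ?A"
    using inj_supply_vector by (rule inj_on_subset) simp
  show ?thesis
  proof
    assume "u \<in> supply_region pl x"
    then obtain f where f: "\<forall>v\<in>supply_vector x ` ?A. 0 \<le> f v" "sum f (supply_vector x ` ?A) = 1"
      "(\<Sum>v\<in>supply_vector x ` ?A. f v *\<^sub>R v) = u"
      by (auto simp: supply_region_def convex_hull_finite finite_purchase_set)
    have "f (supply_vector x a) \<le> 1" if "a \<in> ?A" for a
    proof -
      have "f (supply_vector x a) \<le> sum f (supply_vector x ` ?A)"
        using f(1) that finite_purchase_set[of pl x] by (intro member_le_sum) auto
      then show ?thesis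
        using f(2) by simp
    qed
    with f show "\<exists>\<theta>. (\<forall>a\<in>?A. 0 \<le> \<theta> a \<and> \<theta> a \<le> 1) \<and> (\<Sum>a\<in>?A. \<theta> a) = 1
        \<and> u = (\<Sum>a\<in>?A. \<theta> a *\<^sub>R supply_vector x a)"
      by (intro exI[of _ "\<lambda>a. f (supply_vector x a)"]) (auto simp: sum.reindex[OF inj])
  next
    assume "\<exists>\<theta>. (\<forall>a\<in>?A. 0 \<le> \<theta> a \<and> \<theta> a \<le> 1) \<and> (\<Sum>a\<in>?A. \<theta> a) = 1
        \<and> u = (\<Sum>a\<in>?A. \<theta> a *\<^sub>R supply_vector x a)"
    then show "u \<in> supply_region pl x"
      by (auto simp: supply_region_def finite_purchase_set intro!: convex_sum convex_convex_hull
          intro: hull_inc)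
  qed
qed

context
  fixes pl :: "('m::finite, 'k::finite, 'y) plant" and y :: 'y
  assumes valid: "valid_plant pl" and y: "y \<in> demand_states pl"
begin

lemma demand_law_range:
  assumes "p \<in> price_set pl k"
  shows "set_pmf (demand_law pl k p y) \<subseteq> {0..int (demand_max pl k)}"
  using valid y assms by (simp add: valid_plant_def)

lemma mean_demand_eq_sum:
  assumes "p \<in> price_set pl k"
  shows "mean_demand pl k p y
    = (\<Sum>d\<in>{0..int (demand_max pl k)}. real_of_int d * pmf (demand_law pl k p y) d)"
  unfolding mean_demand_def using demand_law_range[OF assms]
  by (intro integral_measure_pmf_real) auto

lemma mean_demand_bounds:
  assumes "p \<in> price_set pl k"
  shows "0 \<le> mean_demand pl k p y" "mean_demand pl k p y \<le> real (demand_max pl k)"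
proof -
  show "0 \<le> mean_demand pl k p y"
    unfolding mean_demand_eq_sum[OF assms] by (auto intro!: sum_nonneg)
  have "AE d in measure_pmf (demand_law pl k p y). 0 \<le> d \<and> d \<le> int (demand_max pl k)"
    using demand_law_range[OF assms] by (auto simp: AE_measure_pmf_iff)
  then have ae: "AE d in measure_pmf (demand_law pl k p y).
      real_of_int d \<le> real (demand_max pl k) \<and> \<bar>real_of_int d\<bar> \<le> real (demand_max pl k)"
    by eventually_elim linarith
  then show "mean_demand pl k p y \<le> real (demand_max pl k)"
    unfolding mean_demand_def
    by (intro measure_pmf.integral_le_const measure_pmf.integrable_const_bound) auto
qed

lemma continuous_mean_demand: "continuous_on (price_set pl k) (\<lambda>p. mean_demand pl k p y)"
  using valid y by (auto simp: valid_plant_def)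

end

lemma continuous_unit_sale_vector: "continuous_on S (unit_sale_vector pl k)"
proof -
  have "continuous_on S (\<lambda>p. unit_sale_vector pl k p $ j)" for j
    by (cases j) (auto intro!: continuous_intros)
  then have "continuous_on S (\<lambda>p. \<chi> j. unit_sale_vector pl k p $ j)"
    by (rule continuous_on_vec_lambda)
  then show ?thesis
    by simp
qed

lemma unit_sale_vector_bounded:
  fixes pl :: "('m::finite, 'k::finite, 'y) plant"
  assumes "valid_plant pl"
  obtains W where "\<And>k p. p \<in> price_set pl k \<Longrightarrow> norm (unit_sale_vector pl k p) \<le> W k" "\<And>k. 0 \<le> W k"
proof -
  have "\<exists>W\<ge>0. \<forall>p\<in>price_set pl k. norm (unit_sale_vector pl k p) \<le> W" for k
  proof -
    have "compact (unit_sale_vector pl k ` price_set pl k)"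
      using assms by (intro compact_continuous_image continuous_unit_sale_vector) (auto simp: valid_plant_def)
    then show ?thesis
      using compact_imp_bounded bounded_pos by (metis imageI less_imp_le)
  qed
  then obtain W where "\<forall>k. 0 \<le> W k \<and> (\<forall>p\<in>price_set pl k. norm (unit_sale_vector pl k p) \<le> W k)"
    by metis
  then show thesis
    using that by blast
qed

lemma norm_demand_region_bounded:
  fixes pl :: "('m::finite, 'k::finite, 'y) plant"
  assumes valid: "valid_plant pl"
  obtains B where "\<And>y u. y \<in> demand_states pl \<Longrightarrow> u \<in> demand_region pl y \<Longrightarrow> norm u \<le> B"
    "\<And>y zp. y \<in> demand_states pl \<Longrightarrow> zp \<in> offer_prices pl \<Longrightarrow> norm (demand_vector pl y zp) \<le> B"
proof -
  obtain W where W: "\<And>k p. p \<in> price_set pl k \<Longrightarrow> norm (unit_sale_vector pl k p) \<le> W k" "\<And>k. 0 \<le> W k"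
    using unit_sale_vector_bounded[OF valid] by blast
  define B where "B = (\<Sum>k\<in>UNIV. real (demand_max pl k) * W k)"
  have *: "norm (demand_vector pl y zp) \<le> B" if y: "y \<in> demand_states pl" and "zp \<in> offer_prices pl" for y zp
  proof -
    have "norm ((real_of_int (fst zp k) * mean_demand pl k (snd zp k) y)
                 *\<^sub>R unit_sale_vector pl k (snd zp k)) \<le> real (demand_max pl k) * W k" for k
    proof -
      have zp: "fst zp k = 0 \<or> fst zp k = 1" "snd zp k \<in> price_set pl k"
        using that by (auto simp: offer_prices_def)
      have "\<bar>real_of_int (fst zp k) * mean_demand pl k (snd zp k) y\<bar> \<le> real (demand_max pl k)"
        using zp(1) mean_demand_bounds[OF valid y zp(2)] by auto
      then show ?thesis
        using W(1)[OF zp(2)] by (auto intro: mult_mono)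
    qed
    then show ?thesis
      unfolding demand_vector_def B_def by (rule sum_norm_le)
  qed
  have "demand_region pl y \<subseteq> cball 0 B" if "y \<in> demand_states pl" for y
    unfolding demand_region_def by (rule hull_minimal) (use * that in auto)
  with * show thesis
    using that by (metis mem_cball_0 subsetD)
qed

lemma finite_offers: "finite {z :: 'k::finite \<Rightarrow> int. \<forall>k. z k \<in> {0, 1}}"
proof -
  have "{z :: 'k \<Rightarrow> int. \<forall>k. z k \<in> {0, 1}} = (\<Pi>\<^sub>E k\<in>UNIV. {0, 1})"
    by auto
  then show ?thesis
    by (simp add: finite_PiE)
qed

text \<open>The price vectors form a compact set by Tychonoff's theorem, each of the finitely many offer vectors
  gives a continuous payoff, and the hull of a compact set is compact in finite dimension.\<close>

lemma compact_demand_region: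
  fixes pl :: "('m::finite, 'k::finite, 'y) plant"
  assumes valid: "valid_plant pl" and y: "y \<in> demand_states pl"
  shows "compact (demand_region pl y)"
proof -
  define K where "K = (\<Pi>\<^sub>E k\<in>UNIV. price_set pl k)"
  have "compact K"
    unfolding K_def compactin_euclidean_iff[symmetric] euclidean_product_topology[symmetric]
    using valid by (subst compactin_PiE) (auto simp: valid_plant_def)
  have price: "continuous_on K (\<lambda>p. p k)" for k
    by (rule continuous_on_subset[OF continuous_on_product_coordinates]) simp
  have "continuous_on K (\<lambda>p. mean_demand pl k (p k) y)" for k
    by (rule continuous_on_compose2[OF continuous_mean_demand[OF valid y] price]) (auto simp: K_def)
  moreover have "continuous_on K (\<lambda>p. unit_sale_vector pl k (p k))" for k
    by (rule continuous_on_compose2[OF continuous_unit_sale_vector price]) (rule subset_UNIV)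
  ultimately have "continuous_on K (\<lambda>p. demand_vector pl y (z, p))" for z
    unfolding demand_vector_def fst_conv snd_conv by (intro continuous_intros)
  then have "compact ((\<lambda>p. demand_vector pl y (z, p)) ` K)" for z
    using \<open>compact K\<close> by (rule compact_continuous_image)
  then have "compact (\<Union>z\<in>{z. \<forall>k. z k \<in> {0, 1}}. (\<lambda>p. demand_vector pl y (z, p)) ` K)"
    using finite_offers by (intro compact_UN) auto
  also have "(\<Union>z\<in>{z. \<forall>k. z k \<in> {0, 1}}. (\<lambda>p. demand_vector pl y (z, p)) ` K)
      = demand_vector pl y ` offer_prices pl"
  proof (intro equalityI subsetI)
    fix u assume "u \<in> demand_vector pl y ` offer_prices pl"
    then obtain z p where "(z, p) \<in> offer_prices pl" "u = demand_vector pl y (z, p)"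
      by auto
    then show "u \<in> (\<Union>z\<in>{z. \<forall>k. z k \<in> {0, 1}}. (\<lambda>p. demand_vector pl y (z, p)) ` K)"
      unfolding K_def offer_prices_def by (intro UN_I[of z] image_eqI[of _ _ p]) auto
  next
    fix u assume "u \<in> (\<Union>z\<in>{z. \<forall>k. z k \<in> {0, 1}}. (\<lambda>p. demand_vector pl y (z, p)) ` K)"
    then obtain z p where "\<forall>k. z k \<in> {0, 1}" "p \<in> K" "u = demand_vector pl y (z, p)"
      by blast
    then show "u \<in> demand_vector pl y ` offer_prices pl"
      unfolding K_def offer_prices_def by (intro image_eqI[of _ _ "(z, p)"]) auto
  qed
  finally show ?thesis
    unfolding demand_region_def by (rule compact_convex_hull)
qed

lemma space_offer_price_space:
  fixes pl :: "('m, 'k::finite, 'y) plant"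
  shows "space (offer_price_space pl) = offer_prices pl"
  by (auto simp: offer_price_space_def offer_prices_def space_pair_measure space_PiM
        space_restrict_space PiE_iff)

lemma measurable_demand_vector_nth:
  fixes pl :: "('m::finite, 'k::finite, 'y) plant"
  assumes valid: "valid_plant pl" and y: "y \<in> demand_states pl"
  shows "(\<lambda>zp. real_of_int (fst zp k)) \<in> borel_measurable (offer_price_space pl)"
    "(\<lambda>zp. mean_demand pl k (snd zp k) y) \<in> borel_measurable (offer_price_space pl)"
    "(\<lambda>zp. snd zp k) \<in> borel_measurable (offer_price_space pl)"
    "(\<lambda>zp. demand_vector pl y zp $ j) \<in> borel_measurable (offer_price_space pl)"
proof -
  have z: "(\<lambda>zp. fst zp k) \<in> measurable (offer_price_space pl) (count_space {0, 1})" for k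
    unfolding offer_price_space_def
    by (intro measurable_compose[OF measurable_fst] measurable_component_singleton) simp
  have p: "(\<lambda>zp. snd zp k) \<in> measurable (offer_price_space pl) (restrict_space borel (price_set pl k))" for k
    unfolding offer_price_space_def
    by (intro measurable_compose[OF measurable_snd] measurable_component_singleton) simp
  show 1: "(\<lambda>zp. real_of_int (fst zp k)) \<in> borel_measurable (offer_price_space pl)" for k
    using z by (rule measurable_compose) simp
  show 2: "(\<lambda>zp. mean_demand pl k (snd zp k) y) \<in> borel_measurable (offer_price_space pl)" for k
    using p by (rule measurable_compose)
      (rule borel_measurable_continuous_on_restrict[OF continuous_mean_demand[OF valid y]])
  show 3: "(\<lambda>zp. snd zp k) \<in> borel_measurable (offer_price_space pl)" for k
    using p[of k] by (simp add: measurable_restrict_space2_iff)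
  have "(\<lambda>zp. unit_sale_vector pl k (snd zp k) $ j) \<in> borel_measurable (offer_price_space pl)" for k
    using 3[of k] by (cases j) simp_all
  then show "(\<lambda>zp. demand_vector pl y zp $ j) \<in> borel_measurable (offer_price_space pl)"
    unfolding demand_vector_nth by (intro borel_measurable_sum borel_measurable_times 1 2)
qed

section \<open>Randomized offers and prices\<close>

lemma convex_demand_region: "convex (demand_region pl y)"
  by (simp add: demand_region_def)

lemma convex_supply_region: "convex (supply_region pl x)"
  by (simp add: supply_region_def)

lemma demand_vector_mem_region:
  "zp \<in> offer_prices pl \<Longrightarrow> demand_vector pl y zp \<in> demand_region pl y"
  by (simp add: demand_region_def hull_inc)

lemma supply_vector_mem_region:
  "a \<in> purchase_set pl x \<Longrightarrow> supply_vector x a \<in> supply_region pl x"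
  by (simp add: supply_region_def hull_inc)

lemma offer_prices_nonempty:
  assumes "valid_plant pl"
  shows "\<exists>p. (\<lambda>_. 0, p) \<in> offer_prices pl"
proof -
  have "\<exists>p. \<forall>k. p k \<in> price_set pl k"
    using assms by (intro choice) (auto simp: valid_plant_def)
  then show ?thesis
    by (auto simp: offer_prices_def)
qed

lemma zero_mem_demand_region:
  assumes "valid_plant pl"
  shows "0 \<in> demand_region pl y"
proof -
  obtain p where "(\<lambda>_. 0, p) \<in> offer_prices pl"
    using offer_prices_nonempty[OF assms] by blast
  from demand_vector_mem_region[OF this, of y] show ?thesis
    by (simp add: demand_vector_def)
qed

context
  fixes pl :: "('m::finite, 'k::finite, 'y) plant" and y :: 'y
    and \<nu> :: "(('k \<Rightarrow> int) \<times> ('k \<Rightarrow> real)) measure"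
  assumes valid: "valid_plant pl" and y: "y \<in> demand_states pl"
    and \<nu>: "prob_space \<nu>" "sets \<nu> = sets (offer_price_space pl)"
begin

interpretation \<nu>: prob_space \<nu> by fact

lemma space_randomization: "space \<nu> = offer_prices pl"
  using sets_eq_imp_space_eq[OF \<nu>(2)] by (simp add: space_offer_price_space)

lemma randomization_measurable:
  "f \<in> borel_measurable (offer_price_space pl) \<Longrightarrow> f \<in> borel_measurable \<nu>"
  using measurable_cong_sets[OF \<nu>(2) refl] by blast

lemma integrable_demand_vector_nth: "integrable \<nu> (\<lambda>zp. demand_vector pl y zp $ j)"
proof -
  obtain B where B: "\<And>y zp. y \<in> demand_states pl \<Longrightarrow> zp \<in> offer_prices pl \<Longrightarrow> norm (demand_vector pl y zp) \<le> B"
    using norm_demand_region_bounded[OF valid] by metis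
  show ?thesis
  proof (rule \<nu>.integrable_const_bound[where B = B])
    show "AE zp in \<nu>. norm (demand_vector pl y zp $ j) \<le> B"
    proof (rule AE_I2)
      fix zp assume "zp \<in> space \<nu>"
      then have "norm (demand_vector pl y zp) \<le> B"
        using B[OF y] by (simp add: space_randomization)
      then show "norm (demand_vector pl y zp $ j) \<le> B"
        using component_le_norm_cart[of "demand_vector pl y zp" j] by simp
    qed
  qed (intro randomization_measurable measurable_demand_vector_nth(4) valid y)
qed

lemma randomization_bound:
  assumes "zp \<in> space \<nu>"
  shows "\<bar>real_of_int (fst zp k) * mean_demand pl k (snd zp k) y\<bar> \<le> real (demand_max pl k)"
proof -
  have zp: "fst zp k = 0 \<or> fst zp k = 1" "snd zp k \<in> price_set pl k"
    using assms by (auto simp: space_randomization offer_prices_def)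
  then show ?thesis
    using mean_demand_bounds[OF valid y zp(2)] by auto
qed

lemma integrable_sale: "integrable \<nu> (\<lambda>zp. real_of_int (fst zp k) * mean_demand pl k (snd zp k) y)"
  by (rule \<nu>.integrable_const_bound[where B = "real (demand_max pl k)"])
    (auto intro!: AE_I2 randomization_bound randomization_measurable borel_measurable_times
        measurable_demand_vector_nth[OF valid y] simp del: abs_mult)

lemma integrable_revenue:
  "integrable \<nu> (\<lambda>zp. real_of_int (fst zp k) * (snd zp k - assembly_cost pl k)
     * mean_demand pl k (snd zp k) y)"
proof -
  obtain W where W: "\<And>k p. p \<in> price_set pl k \<Longrightarrow> norm (unit_sale_vector pl k p) \<le> W k" "\<And>k. 0 \<le> W k"
    using unit_sale_vector_bounded[OF valid] by blast
  show ?thesis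
  proof (rule \<nu>.integrable_const_bound[where B = "real (demand_max pl k) * W k"])
    show "AE zp in \<nu>. norm (real_of_int (fst zp k) * (snd zp k - assembly_cost pl k)
            * mean_demand pl k (snd zp k) y) \<le> real (demand_max pl k) * W k"
    proof (rule AE_I2)
      fix zp assume zp: "zp \<in> space \<nu>"
      then have "\<bar>snd zp k - assembly_cost pl k\<bar> \<le> W k"
        using W(1)[of "snd zp k" k] component_le_norm_cart[of "unit_sale_vector pl k (snd zp k)" None]
        by (auto simp: space_randomization offer_prices_def)
      then have "\<bar>real_of_int (fst zp k) * mean_demand pl k (snd zp k) y\<bar> * \<bar>snd zp k - assembly_cost pl k\<bar>
          \<le> real (demand_max pl k) * W k"
        by (intro mult_mono randomization_bound zp) auto
      then show "norm (real_of_int (fst zp k) * (snd zp k - assembly_cost pl k)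
            * mean_demand pl k (snd zp k) y) \<le> real (demand_max pl k) * W k"
        by (simp add: abs_mult mult_ac)
    qed
  qed (intro randomization_measurable borel_measurable_times borel_measurable_diff borel_measurable_const
        measurable_demand_vector_nth[OF valid y])
qed

lemma integral_demand_vector_nth:
  "(\<integral>zp. demand_vector pl y zp $ None \<partial>\<nu>) = (\<Sum>k\<in>UNIV.
     (\<integral>zp. real_of_int (fst zp k) * (snd zp k - assembly_cost pl k)
              * mean_demand pl k (snd zp k) y \<partial>\<nu>))"
  "(\<integral>zp. demand_vector pl y zp $ Some m \<partial>\<nu>) = (\<Sum>k\<in>UNIV. real (usage pl m k) *
     (\<integral>zp. real_of_int (fst zp k) * mean_demand pl k (snd zp k) y \<partial>\<nu>))"
proof -
  have "(\<integral>zp. demand_vector pl y zp $ None \<partial>\<nu>) = (\<integral>zp. (\<Sum>k\<in>UNIV.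
     real_of_int (fst zp k) * (snd zp k - assembly_cost pl k) * mean_demand pl k (snd zp k) y) \<partial>\<nu>)"
    by (simp add: demand_vector_nth mult_ac)
  then show "(\<integral>zp. demand_vector pl y zp $ None \<partial>\<nu>) = (\<Sum>k\<in>UNIV.
     (\<integral>zp. real_of_int (fst zp k) * (snd zp k - assembly_cost pl k)
              * mean_demand pl k (snd zp k) y \<partial>\<nu>))"
    using integrable_revenue by (simp add: Bochner_Integration.integral_sum)
  have "(\<integral>zp. demand_vector pl y zp $ Some m \<partial>\<nu>) = (\<integral>zp. (\<Sum>k\<in>UNIV. real (usage pl m k) *
     (real_of_int (fst zp k) * mean_demand pl k (snd zp k) y)) \<partial>\<nu>)"
    by (simp add: demand_vector_nth mult_ac)
  then show "(\<integral>zp. demand_vector pl y zp $ Some m \<partial>\<nu>) = (\<Sum>k\<in>UNIV. real (usage pl m k) *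
     (\<integral>zp. real_of_int (fst zp k) * mean_demand pl k (snd zp k) y \<partial>\<nu>))"
    using integrable_sale by (simp add: Bochner_Integration.integral_sum)
qed

text \<open>The mean of a distribution on a compact set lies in the hull, because in each direction it is
  at most the maximum over the hull.\<close>

lemma integral_demand_vector_mem_region:
  "(\<chi> j. \<integral>zp. demand_vector pl y zp $ j \<partial>\<nu>) \<in> demand_region pl y"
proof (rule mem_convex_if_supported[OF convex_demand_region
      compact_imp_closed[OF compact_demand_region[OF valid y]]])
  fix l
  obtain u where u: "u \<in> demand_region pl y" "\<And>v. v \<in> demand_region pl y \<Longrightarrow> l \<bullet> v \<le> l \<bullet> u"
    using maximal_inner_attained[OF compact_demand_region[OF valid y], of l] zero_mem_demand_region[OF valid]
    by blast
  have int: "integrable \<nu> (\<lambda>zp. \<Sum>j\<in>UNIV. l $ j * demand_vector pl y zp $ j)"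
    using integrable_demand_vector_nth by simp
  have "l \<bullet> (\<chi> j. \<integral>zp. demand_vector pl y zp $ j \<partial>\<nu>) = (\<integral>zp. l \<bullet> demand_vector pl y zp \<partial>\<nu>)"
    using integrable_demand_vector_nth by (simp add: inner_vec_def)
  also have "\<dots> \<le> l \<bullet> u"
    using int by (intro \<nu>.integral_le_const AE_I2)
      (auto simp: inner_vec_def[symmetric, where 'a = real, unfolded inner_real_def] space_randomization
        intro!: u(2) demand_vector_mem_region)
  finally show "\<exists>u\<in>demand_region pl y. l \<bullet> (\<chi> j. \<integral>zp. demand_vector pl y zp $ j \<partial>\<nu>) \<le> l \<bullet> u"
    using u(1) by blast
qed

end

text \<open>Converse of the previous lemma. A point of the hull is a finite convex combination, and the
  distribution that plays the corresponding decisions with these weights realizes it.\<close>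

lemma demand_region_realized:
  fixes pl :: "('m::finite, 'k::finite, 'y) plant"
  assumes valid: "valid_plant pl" and y: "y \<in> demand_states pl" and v: "v \<in> demand_region pl y"
  shows "\<exists>\<nu>. prob_space \<nu> \<and> sets \<nu> = sets (offer_price_space pl) \<and>
    v = (\<chi> j. \<integral>zp. demand_vector pl y zp $ j \<partial>\<nu>)"
proof -
  from v obtain S f where S: "finite S" "S \<subseteq> demand_vector pl y ` offer_prices pl"
    and f: "\<forall>u\<in>S. 0 \<le> f u" "sum f S = 1" "(\<Sum>u\<in>S. f u *\<^sub>R u) = v"
    by (auto simp: demand_region_def convex_hull_explicit)
  obtain zp0 where zp0: "zp0 \<in> offer_prices pl"
    using offer_prices_nonempty[OF valid] by blast
  have "\<forall>u\<in>S. \<exists>zp\<in>offer_prices pl. u = demand_vector pl y zp"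
    using S(2) by blast
  then obtain g where g: "\<forall>u\<in>S. g u \<in> offer_prices pl \<and> u = demand_vector pl y (g u)"
    by metis
  \<comment> \<open>Outside \<open>S\<close>, a set of probability zero, the value only has to be admissible for measurability.\<close>
  define h where "h u = (if u \<in> S then g u else zp0)" for u
  define w where "w u = (if u \<in> S then f u else 0)" for u
  have w: "\<And>u. 0 \<le> w u" "(\<integral>\<^sup>+u. ennreal (w u) \<partial>count_space UNIV) = 1"
  proof -
    show "0 \<le> w u" for u
      using f(1) by (simp add: w_def)
    have "(\<integral>\<^sup>+u. ennreal (w u) \<partial>count_space UNIV) = (\<Sum>u\<in>S. ennreal (f u))"
      by (subst nn_integral_count_space'[OF S(1)]) (auto simp: w_def)
    also have "\<dots> = ennreal (sum f S)"
      using f(1) by (intro sum_ennreal) auto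
    finally show "(\<integral>\<^sup>+u. ennreal (w u) \<partial>count_space UNIV) = 1"
      using f(2) by simp
  qed
  define q where "q = embed_pmf w"
  have q: "pmf q u = w u" for u
    unfolding q_def using w by (rule pmf_embed_pmf)
  define \<nu> where "\<nu> = distr (measure_pmf q) (offer_price_space pl) h"
  have h: "h \<in> measurable (measure_pmf q) (offer_price_space pl)"
    using g zp0 by (auto simp: space_offer_price_space h_def)
  have "(\<integral>zp. demand_vector pl y zp $ j \<partial>\<nu>) = v $ j" for j
  proof -
    have "(\<integral>zp. demand_vector pl y zp $ j \<partial>\<nu>) = (\<integral>u. demand_vector pl y (h u) $ j \<partial>measure_pmf q)"
      unfolding \<nu>_def using h measurable_demand_vector_nth(4)[OF valid y] by (rule integral_distr)
    also have "\<dots> = (\<Sum>u\<in>S. demand_vector pl y (h u) $ j * pmf q u)"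
      using S(1) by (rule integral_measure_pmf_real) (auto simp: set_pmf_eq q w_def split: if_splits)
    also have "\<dots> = (\<Sum>u\<in>S. f u * u $ j)"
      using g by (intro sum.cong refl) (simp add: h_def q w_def mult.commute)
    also have "\<dots> = v $ j"
      by (simp add: f(3)[symmetric])
    finally show ?thesis .
  qed
  moreover have "prob_space \<nu>"
    unfolding \<nu>_def by (rule measure_pmf.prob_space_distr[OF h])
  ultimately show ?thesis
    by (intro exI[of _ \<nu>]) (simp add: \<nu>_def vec_eq_iff)
qed

section \<open>The optimization problem over two compact sets\<close>

text \<open>A feasible point is a choice of one point of the payoff region in every state: \<open>\<theta>(_, x)\<close> picks a
  point of the supply region of \<open>x\<close> and \<open>\<nu> y\<close> a point of the demand region of \<open>y\<close>. The hatted
  variables are the coordinates of the two weighted sums.\<close>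

lemma program_value_imp_selections:
  fixes pl :: "('m::finite, 'k::finite, 'y) plant"
  assumes valid: "valid_plant pl"
    and X: "bounded_family \<pi>X (supply_states pl) (supply_region pl) BX"
    and Y: "bounded_family \<pi>Y (demand_states pl) (demand_region pl) BY"
    and "program_value pl \<pi>X \<pi>Y \<phi>"
  shows "(\<exists>u\<in>weighted_selections \<pi>X (supply_states pl) (supply_region pl).
     \<exists>v\<in>weighted_selections \<pi>Y (demand_states pl) (demand_region pl).
       (\<forall>m. v $ Some m \<le> u $ Some m) \<and> \<phi> = u $ None + v $ None)"
proof -
  from assms(4) obtain c r \<theta> a_hat \<mu>_hat \<nu> where *: "\<phi> = - c + r" "\<forall>m. a_hat m \<ge> \<mu>_hat m"
    "c = (\<Sum>\<^sub>\<infinity>x\<in>supply_states pl. \<pi>X x * (\<Sum>a\<in>purchase_set pl x. \<theta> a x * purchase_cost a x))"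
    "r = (\<Sum>\<^sub>\<infinity>y\<in>demand_states pl. \<pi>Y y * (\<Sum>k\<in>UNIV.
               (\<integral>zp. real_of_int (fst zp k) * (snd zp k - assembly_cost pl k)
                      * mean_demand pl k (snd zp k) y \<partial>\<nu> y)))"
    "\<forall>m. a_hat m = (\<Sum>\<^sub>\<infinity>x\<in>supply_states pl.
               \<pi>X x * (\<Sum>a\<in>purchase_set pl x. \<theta> a x * real_of_int (a m)))"
    "\<forall>m. \<mu>_hat m = (\<Sum>\<^sub>\<infinity>y\<in>demand_states pl. \<pi>Y y * (\<Sum>k\<in>UNIV. real (usage pl m k) *
               (\<integral>zp. real_of_int (fst zp k) * mean_demand pl k (snd zp k) y \<partial>\<nu> y)))"
    and \<theta>: "\<forall>x\<in>supply_states pl. \<forall>a\<in>purchase_set pl x. 0 \<le> \<theta> a x \<and> \<theta> a x \<le> 1"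
      "\<forall>x\<in>supply_states pl. (\<Sum>a\<in>purchase_set pl x. \<theta> a x) = 1"
    and \<nu>: "\<forall>y\<in>demand_states pl. prob_space (\<nu> y) \<and> sets (\<nu> y) = sets (offer_price_space pl)"
    unfolding program_value_def by (elim exE conjE) (rule that)
  define u where "u x = (\<Sum>a\<in>purchase_set pl x. \<theta> a x *\<^sub>R supply_vector x a)" for x
  define v where "v y = (\<chi> j. \<integral>zp. demand_vector pl y zp $ j \<partial>\<nu> y)" for y
  have u: "\<forall>x\<in>supply_states pl. u x \<in> supply_region pl x"
  proof
    fix x assume "x \<in> supply_states pl"
    with \<theta> show "u x \<in> supply_region pl x"
      unfolding supply_region_iff u_def by (intro exI[of _ "\<lambda>a. \<theta> a x"]) auto
  qed
  have v: "\<forall>y\<in>demand_states pl. v y \<in> demand_region pl y"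
    unfolding v_def using \<nu> by (auto intro: integral_demand_vector_mem_region[OF valid])
  note uv_nth = bounded_family.linear_weighted_selection[OF X u bounded_linear_vec_nth]
    bounded_family.linear_weighted_selection[OF Y v bounded_linear_vec_nth]
  have "(\<Sum>\<^sub>\<infinity>x\<in>supply_states pl. \<pi>X x *\<^sub>R u x) $ None = - c"
    unfolding uv_nth * infsum_uminus[symmetric]
    by (simp add: u_def sum_negf)
  moreover have "(\<Sum>\<^sub>\<infinity>x\<in>supply_states pl. \<pi>X x *\<^sub>R u x) $ Some m = a_hat m" for m
    unfolding uv_nth *(5)[rule_format] by (simp add: u_def)
  moreover have "(\<Sum>\<^sub>\<infinity>y\<in>demand_states pl. \<pi>Y y *\<^sub>R v y) $ None = r"
    unfolding uv_nth *
    using \<nu> by (intro infsum_cong) (simp add: v_def integral_demand_vector_nth[OF valid])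
  moreover have "(\<Sum>\<^sub>\<infinity>y\<in>demand_states pl. \<pi>Y y *\<^sub>R v y) $ Some m = \<mu>_hat m" for m
    unfolding uv_nth *(6)[rule_format]
    using \<nu> by (intro infsum_cong) (simp add: v_def integral_demand_vector_nth[OF valid])
  ultimately show ?thesis
    using *(1,2)
    by (intro bexI[OF _ weighted_selectionsI[OF u]] bexI[OF _ weighted_selectionsI[OF v]]) simp
qed

lemma selections_imp_program_value:
  fixes pl :: "('m::finite, 'k::finite, 'y) plant"
  assumes valid: "valid_plant pl"
    and X: "bounded_family \<pi>X (supply_states pl) (supply_region pl) BX"
    and Y: "bounded_family \<pi>Y (demand_states pl) (demand_region pl) BY"
    and "(\<exists>u\<in>weighted_selections \<pi>X (supply_states pl) (supply_region pl).
     \<exists>v\<in>weighted_selections \<pi>Y (demand_states pl) (demand_region pl).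
       (\<forall>m. v $ Some m \<le> u $ Some m) \<and> \<phi> = u $ None + v $ None)"
  shows "program_value pl \<pi>X \<pi>Y \<phi>"
proof -
  from assms(4) obtain u' v' where u': "u' \<in> weighted_selections \<pi>X (supply_states pl) (supply_region pl)"
    and v': "v' \<in> weighted_selections \<pi>Y (demand_states pl) (demand_region pl)"
    and uv': "\<forall>m. v' $ Some m \<le> u' $ Some m" "\<phi> = u' $ None + v' $ None"
    by blast
  from u' obtain u where u: "\<forall>x\<in>supply_states pl. u x \<in> supply_region pl x"
    and u'_eq: "u' = (\<Sum>\<^sub>\<infinity>x\<in>supply_states pl. \<pi>X x *\<^sub>R u x)"
    by (auto simp: weighted_selections_def)
  from v' obtain v where v: "\<forall>y\<in>demand_states pl. v y \<in> demand_region pl y"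
    and v'_eq: "v' = (\<Sum>\<^sub>\<infinity>y\<in>demand_states pl. \<pi>Y y *\<^sub>R v y)"
    by (auto simp: weighted_selections_def)
  note le = uv'(1)[unfolded u'_eq v'_eq] and \<phi> = uv'(2)[unfolded u'_eq v'_eq]
  note uv_nth = bounded_family.linear_weighted_selection[OF X u bounded_linear_vec_nth]
    bounded_family.linear_weighted_selection[OF Y v bounded_linear_vec_nth]
  from bchoice[OF u[unfolded supply_region_iff]] obtain \<theta> where \<theta>: "\<forall>x\<in>supply_states pl. (\<forall>a\<in>purchase_set pl x. 0 \<le> \<theta> x a \<and> \<theta> x a \<le> 1)
      \<and> (\<Sum>a\<in>purchase_set pl x. \<theta> x a) = 1
      \<and> u x = (\<Sum>a\<in>purchase_set pl x. \<theta> x a *\<^sub>R supply_vector x a)"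
    by (elim exE)
  have "\<forall>y\<in>demand_states pl. \<exists>\<nu>. prob_space \<nu> \<and> sets \<nu> = sets (offer_price_space pl) \<and>
      v y = (\<chi> j. \<integral>zp. demand_vector pl y zp $ j \<partial>\<nu>)"
    using v demand_region_realized[OF valid] by blast
  from bchoice[OF this] obtain \<nu> where \<nu>: "\<forall>y\<in>demand_states pl. prob_space (\<nu> y) \<and>
      sets (\<nu> y) = sets (offer_price_space pl) \<and> v y = (\<chi> j. \<integral>zp. demand_vector pl y zp $ j \<partial>\<nu> y)"
    by (elim exE)
  define c where "c = (\<Sum>\<^sub>\<infinity>x\<in>supply_states pl. \<pi>X x * (\<Sum>a\<in>purchase_set pl x. \<theta> x a * purchase_cost a x))"
  define r where "r = (\<Sum>\<^sub>\<infinity>y\<in>demand_states pl. \<pi>Y y * (\<Sum>k\<in>UNIV.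
               (\<integral>zp. real_of_int (fst zp k) * (snd zp k - assembly_cost pl k)
                      * mean_demand pl k (snd zp k) y \<partial>\<nu> y)))"
  define a_hat where "a_hat m = (\<Sum>\<^sub>\<infinity>x\<in>supply_states pl.
               \<pi>X x * (\<Sum>a\<in>purchase_set pl x. \<theta> x a * real_of_int (a m)))" for m
  define \<mu>_hat where "\<mu>_hat m = (\<Sum>\<^sub>\<infinity>y\<in>demand_states pl. \<pi>Y y * (\<Sum>k\<in>UNIV. real (usage pl m k) *
               (\<integral>zp. real_of_int (fst zp k) * mean_demand pl k (snd zp k) y \<partial>\<nu> y)))" for m
  have c: "(\<Sum>\<^sub>\<infinity>x\<in>supply_states pl. \<pi>X x *\<^sub>R u x) $ None = - c"
    unfolding uv_nth c_def infsum_uminus[symmetric]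
    using \<theta> by (intro infsum_cong) (simp add: sum_negf)
  have a: "(\<Sum>\<^sub>\<infinity>x\<in>supply_states pl. \<pi>X x *\<^sub>R u x) $ Some m = a_hat m" for m
    unfolding uv_nth a_hat_def using \<theta> by (intro infsum_cong) simp
  have r: "(\<Sum>\<^sub>\<infinity>y\<in>demand_states pl. \<pi>Y y *\<^sub>R v y) $ None = r"
    unfolding uv_nth r_def
    using \<nu> by (intro infsum_cong) (simp add: integral_demand_vector_nth[OF valid])
  have \<mu>: "(\<Sum>\<^sub>\<infinity>y\<in>demand_states pl. \<pi>Y y *\<^sub>R v y) $ Some m = \<mu>_hat m" for m
    unfolding uv_nth \<mu>_hat_def
    using \<nu> by (intro infsum_cong) (simp add: integral_demand_vector_nth[OF valid])
  have objective: "\<phi> = - c + r"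
    unfolding \<phi> c r ..
  have enough: "\<forall>m. a_hat m \<ge> \<mu>_hat m"
    using le unfolding a \<mu> .
  have weights: "\<forall>x\<in>supply_states pl. \<forall>a\<in>purchase_set pl x. 0 \<le> \<theta> x a \<and> \<theta> x a \<le> 1"
    "\<forall>x\<in>supply_states pl. (\<Sum>a\<in>purchase_set pl x. \<theta> x a) = 1"
    using \<theta> by blast+
  have laws: "\<forall>y\<in>demand_states pl. prob_space (\<nu> y) \<and> sets (\<nu> y) = sets (offer_price_space pl)"
    using \<nu> by blast
  show ?thesis
    unfolding program_value_def
    by (rule exI[of _ c], rule exI[of _ r], rule exI[of _ "\<lambda>a x. \<theta> x a"], rule exI[of _ a_hat],
        rule exI[of _ \<mu>_hat], rule exI[of _ \<nu>], intro conjI objective enough c_def r_def weights laws)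
      (rule allI, rule a_hat_def, rule allI, rule \<mu>_hat_def)
qed

text \<open>If the objective were at least some \<open>c > \<phi>\<close> infinitely often, a convergent subsequence would have a
  limit that satisfies the constraints exactly and has objective at least \<open>c\<close>.\<close>

lemma limsup_almost_feasible_le:
  fixes U V :: "(real ^ 'm::finite option) set"
  assumes "compact U" "compact V"
    and bound: "\<And>u v. u \<in> U \<Longrightarrow> v \<in> V \<Longrightarrow> \<forall>m. v $ Some m \<le> u $ Some m \<Longrightarrow> u $ None + v $ None \<le> \<phi>"
    and mem: "\<And>n. f n \<in> U" "\<And>n. g n \<in> V"
    and gap: "\<And>n m. g n $ Some m \<le> f n $ Some m + e m n" "\<And>m. e m \<longlonglongrightarrow> 0"
  shows "limsup (\<lambda>n. ereal (f n $ None + g n $ None)) \<le> ereal \<phi>"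
proof -
  have *: "eventually (\<lambda>n. f n $ None + g n $ None < c) sequentially" if "c > \<phi>" for c
  proof (rule ccontr)
    assume "\<not> eventually (\<lambda>n. f n $ None + g n $ None < c) sequentially"
    then have "infinite {n. f n $ None + g n $ None \<ge> c}"
      unfolding infinite_nat_iff_unbounded_le by (auto simp: eventually_sequentially not_less)
    from infinite_enumerate[OF this]
    obtain s :: "nat \<Rightarrow> nat" where s: "strict_mono s" "\<And>n. c \<le> f (s n) $ None + g (s n) $ None"
      by auto
    have "seq_compact (U \<times> V)"
      using assms(1,2) compact_Times compact_imp_seq_compact by blast
    moreover have "\<forall>n. (f (s n), g (s n)) \<in> U \<times> V"
      using mem by simp
    ultimately obtain p t where t: "p \<in> U \<times> V" "strict_mono t"
      "((\<lambda>n. (f (s n), g (s n))) \<circ> t) \<longlonglongrightarrow> p"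
      by (rule seq_compactE)
    obtain u v where uv: "p = (u, v)"
      by (cases p)
    have lim: "(\<lambda>n. f (s (t n))) \<longlonglongrightarrow> u" "(\<lambda>n. g (s (t n))) \<longlonglongrightarrow> v"
      using tendsto_fst[OF t(3)] tendsto_snd[OF t(3)] by (simp_all add: o_def uv)
    have "strict_mono (\<lambda>n. s (t n))"
      using strict_mono_o[OF s(1) t(2)] by (simp add: o_def)
    then have e: "(\<lambda>n. e m (s (t n))) \<longlonglongrightarrow> 0" for m
      using LIMSEQ_subseq_LIMSEQ[OF gap(2)] by (fastforce simp: o_def)
    have "v $ Some m \<le> u $ Some m + 0" for m
      using gap(1) by (intro LIMSEQ_le[OF tendsto_vec_nth[OF lim(2)]
            tendsto_add[OF tendsto_vec_nth[OF lim(1)] e]]) blast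
    then have "u $ None + v $ None \<le> \<phi>"
      using bound[of u v] t(1) by (simp add: uv)
    moreover have "c \<le> u $ None + v $ None"
      using s(2) by (intro LIMSEQ_le_const[OF tendsto_add[OF tendsto_vec_nth[OF lim(1)] tendsto_vec_nth[OF lim(2)]]])
        auto
    ultimately show False
      using \<open>c > \<phi>\<close> by simp
  qed
  show ?thesis
    unfolding Limsup_le_iff
  proof (intro allI impI)
    fix y :: ereal assume "ereal \<phi> < y"
    then obtain c where c: "ereal \<phi> < ereal c" "ereal c < y"
      using ereal_dense2 by blast
    have "eventually (\<lambda>n. f n $ None + g n $ None < c) sequentially"
      using c(1) by (intro *) simp
    then show "eventually (\<lambda>n. ereal (f n $ None + g n $ None) < y) sequentially"
    proof (rule eventually_mono)
      fix n assume "f n $ None + g n $ None < c"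
      then have "ereal (f n $ None + g n $ None) < ereal c"
        by simp
      with c(2) show "ereal (f n $ None + g n $ None) < y"
        by (rule order_less_trans[rotated])
    qed
  qed
qed

text \<open>The feasible set is compact, and nonempty because buying and selling nothing is feasible.\<close>

lemma optimum_attained:
  fixes U V :: "(real ^ 'm::finite option) set"
  assumes "compact U" "compact V" "0 \<in> U" "0 \<in> V"
  shows "\<exists>u\<in>U. \<exists>v\<in>V. (\<forall>m. v $ Some m \<le> u $ Some m) \<and>
    (\<forall>u'\<in>U. \<forall>v'\<in>V. (\<forall>m. v' $ Some m \<le> u' $ Some m)
       \<longrightarrow> u' $ None + v' $ None \<le> u $ None + v $ None)"
proof -
  define F where "F = (U \<times> V) \<inter> {p. \<forall>m. snd p $ Some m \<le> fst p $ Some m}"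
  have "compact F"
    unfolding F_def using assms(1,2)
    by (intro compact_Int_closed compact_Times closed_Collect_all closed_Collect_le continuous_intros)
  moreover have "F \<noteq> {}"
    using assms(3,4) by (force simp: F_def)
  moreover have "continuous_on F (\<lambda>p. fst p $ None + snd p $ None)"
    by (intro continuous_intros)
  ultimately obtain p where p: "p \<in> F"
    "\<And>q. q \<in> F \<Longrightarrow> fst q $ None + snd q $ None \<le> fst p $ None + snd p $ None"
    using continuous_attains_sup[of F "\<lambda>p. fst p $ None + snd p $ None"] by blast
  have "u' $ None + v' $ None \<le> fst p $ None + snd p $ None"
    if "u' \<in> U" "v' \<in> V" "\<forall>m. v' $ Some m \<le> u' $ Some m" for u' v'
    using p(2)[of "(u', v')"] that by (simp add: F_def)
  with p(1) show ?thesis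
    by (intro bexI[of _ "fst p"] bexI[of _ "snd p"]) (auto simp: F_def)
qed

section \<open>Expected payoff of one slot\<close>

context controlled_plant
begin

lemma supply_state_measurable: "supply_state R t \<in> measurable \<Omega> (count_space (supply_states pl))"
  using supply_stationary by (simp add: stationary_process_def)

lemma demand_state_measurable: "demand_state R t \<in> measurable \<Omega> (count_space (demand_states pl))"
  using demand_stationary by (simp add: stationary_process_def)

lemma supply_state_mem: "\<omega> \<in> space \<Omega> \<Longrightarrow> supply_state R t \<omega> \<in> supply_states pl"
  using measurable_space[OF supply_state_measurable] by simp

lemma demand_state_mem: "\<omega> \<in> space \<Omega> \<Longrightarrow> demand_state R t \<omega> \<in> demand_states pl"
  using measurable_space[OF demand_state_measurable] by simp

lemma countable_supply_states: "countable (supply_states pl)"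
  using plant by (simp add: valid_plant_def)

lemma countable_demand_states: "countable (demand_states pl)"
  using plant by (simp add: valid_plant_def)

text \<open>The purchase on slot \<open>0\<close> is admissible, which forces \<open>purchase_max\<close> and \<open>cost_max\<close> to be nonnegative;
  then the empty purchase is allowed in every state.\<close>

lemma zero_mem_supply_region:
  assumes "x \<in> supply_states pl"
  shows "0 \<in> supply_region pl x"
proof -
  obtain \<omega> where \<omega>: "\<omega> \<in> space \<Omega>"
    using not_empty by blast
  let ?a = "purchase R 0 \<omega>" and ?x = "supply_state R 0 \<omega>"
  have a: "?a \<in> purchase_set pl ?x"
    using purchase_option[OF \<omega>] .
  have "0 \<le> purchase_cost ?a ?x"
    using purchase_cost_nonneg[OF plant supply_state_mem[OF \<omega>] a] .
  then have "0 \<le> cost_max pl"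
    using a by (auto simp: purchase_set_def)
  moreover have "0 \<le> purchase_max pl m" for m
  proof -
    have "0 \<le> ?a m" "real_of_int (?a m) \<le> purchase_max pl m"
      using a by (auto simp: purchase_set_def)
    then show ?thesis
      by linarith
  qed
  moreover have "0 \<le> snd x m" for m
    using plant assms by (auto simp: valid_plant_def)
  ultimately have "(\<lambda>_. 0) \<in> purchase_set pl x"
    by (simp add: purchase_set_def purchase_cost_def)
  moreover have "supply_vector x (\<lambda>_. 0) = 0"
    by (rule vec_eq_iff[THEN iffD2, rule_format], case_tac i) (simp_all add: purchase_cost_def)
  ultimately show ?thesis
    using supply_vector_mem_region by metis
qed

text \<open>The means of slot \<open>t\<close> under the control algorithm, and the sets in which they range. The latter
  depend on the plant and the state distributions, not on the algorithm.\<close>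

definition mean_supply :: "nat \<Rightarrow> real ^ 'm option" where
  "mean_supply t = (\<chi> j. expectation (\<lambda>\<omega>. supply_vector (supply_state R t \<omega>) (purchase R t \<omega>) $ j))"

definition sale_vector :: "nat \<Rightarrow> 'w \<Rightarrow> real ^ 'm option" where
  "sale_vector t \<omega> = (\<Sum>k\<in>UNIV. real_of_int (sold R t \<omega> k) *\<^sub>R unit_sale_vector pl k (price R t \<omega> k))"

definition mean_sale :: "nat \<Rightarrow> real ^ 'm option" where
  "mean_sale t = (\<chi> j. expectation (\<lambda>\<omega>. sale_vector t \<omega> $ j))"

definition supply_means :: "(real ^ 'm option) set" where
  "supply_means = weighted_selections (state_prob \<Omega> (supply_state R)) (supply_states pl) (supply_region pl)"

definition demand_means :: "(real ^ 'm option) set" where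
  "demand_means = weighted_selections (state_prob \<Omega> (demand_state R)) (demand_states pl) (demand_region pl)"

lemma supply_family:
  "bounded_family (state_prob \<Omega> (supply_state R)) (supply_states pl) (supply_region pl)
     (cost_max pl + (\<Sum>m\<in>UNIV. purchase_max pl m))"
  using expectation_countable_state(1)[OF supply_state_measurable[of 0] countable_supply_states, of "\<lambda>_. 0" 0]
    norm_supply_region_le[OF plant]
  by unfold_locales (auto simp: state_prob_def[abs_def])

lemma demand_family:
  obtains B where
    "bounded_family (state_prob \<Omega> (demand_state R)) (demand_states pl) (demand_region pl) B"
proof -
  obtain B where B: "\<And>y u. y \<in> demand_states pl \<Longrightarrow> u \<in> demand_region pl y \<Longrightarrow> norm u \<le> B"
    using norm_demand_region_bounded[OF plant] by metis
  have "bounded_family (state_prob \<Omega> (demand_state R)) (demand_states pl) (demand_region pl) B"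
    using expectation_countable_state(1)[OF demand_state_measurable[of 0] countable_demand_states, of "\<lambda>_. 0" 0] B
    by unfold_locales (auto simp: state_prob_def[abs_def])
  then show thesis
    by (rule that)
qed

lemma supply_means_properties:
  "compact supply_means" "convex supply_means" "0 \<in> supply_means"
proof -
  interpret bounded_family "state_prob \<Omega> (supply_state R)" "supply_states pl" "supply_region pl"
    "cost_max pl + (\<Sum>m\<in>UNIV. purchase_max pl m)"
    by (rule supply_family)
  show "compact supply_means" "convex supply_means"
    unfolding supply_means_def
    by (intro compact_weighted_selections convex_weighted_selections compact_supply_region
        convex_supply_region)+
  show "0 \<in> supply_means"
    using weighted_selectionsI[of "supply_states pl" "\<lambda>_. 0" "supply_region pl"
        "state_prob \<Omega> (supply_state R)"] zero_mem_supply_region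
    by (simp add: supply_means_def)
qed

lemma demand_means_properties:
  "compact demand_means" "convex demand_means" "0 \<in> demand_means"
proof -
  obtain B where "bounded_family (state_prob \<Omega> (demand_state R)) (demand_states pl) (demand_region pl) B"
    by (rule demand_family)
  then interpret bounded_family "state_prob \<Omega> (demand_state R)" "demand_states pl" "demand_region pl" B .
  show "compact demand_means" "convex demand_means"
    unfolding demand_means_def
    by (intro compact_weighted_selections convex_weighted_selections compact_demand_region[OF plant]
        convex_demand_region; assumption)+
  show "0 \<in> demand_means"
    using weighted_selectionsI[of "demand_states pl" "\<lambda>_. 0" "demand_region pl"
        "state_prob \<Omega> (demand_state R)"] zero_mem_demand_region[OF plant]
    by (simp add: demand_means_def)
qed

lemma purchase_component_measurable: "(\<lambda>\<omega>. real_of_int (purchase R t \<omega> m)) \<in> borel_measurable \<Omega>"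
  by (rule measurable_compose[OF purchase_measurable]) simp

lemma integrable_supply_vector_nth:
  "integrable \<Omega> (\<lambda>\<omega>. supply_vector (supply_state R t \<omega>) (purchase R t \<omega>) $ j)"
proof (rule integrable_const_bound[where B = "cost_max pl + (\<Sum>m\<in>UNIV. purchase_max pl m)"])
  have "(\<lambda>\<omega>. fst (supply_state R t \<omega>) m) \<in> borel_measurable \<Omega>" for m
    by (rule measurable_compose[OF supply_state_measurable]) simp
  then show "(\<lambda>\<omega>. supply_vector (supply_state R t \<omega>) (purchase R t \<omega>) $ j) \<in> borel_measurable \<Omega>"
    using purchase_component_measurable
    by (cases j) (auto simp: purchase_cost_def intro!: borel_measurable_sum borel_measurable_times
        borel_measurable_uminus)
  show "AE \<omega> in \<Omega>. norm (supply_vector (supply_state R t \<omega>) (purchase R t \<omega>) $ j)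
      \<le> cost_max pl + (\<Sum>m\<in>UNIV. purchase_max pl m)"
  proof (rule AE_I2)
    fix \<omega> assume "\<omega> \<in> space \<Omega>"
    then show "norm (supply_vector (supply_state R t \<omega>) (purchase R t \<omega>) $ j)
      \<le> cost_max pl + (\<Sum>m\<in>UNIV. purchase_max pl m)"
      using norm_supply_vector_le[OF plant supply_state_mem purchase_option]
      by (metis component_le_norm_cart order_trans real_norm_def)
  qed
qed

lemma mean_supply_mem: "mean_supply t \<in> supply_means"
proof -
  have "mean_supply t \<in> weighted_selections (\<lambda>x. prob {\<omega> \<in> space \<Omega>. supply_state R t \<omega> = x})
      (supply_states pl) (supply_region pl)"
    unfolding mean_supply_def
  proof (rule expectation_vector_mem_weighted_selections[OF supply_state_measurable countable_supply_states
        compact_supply_region convex_supply_region norm_supply_region_le[OF plant] integrable_supply_vector_nth])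
    fix l
    obtain v where v: "\<forall>x\<in>supply_states pl. v x \<in> supply_region pl x"
      "\<And>x u. x \<in> supply_states pl \<Longrightarrow> u \<in> supply_region pl x \<Longrightarrow> l \<bullet> u \<le> l \<bullet> v x"
      using maximal_selection[of "supply_states pl" "supply_region pl" l] compact_supply_region
        zero_mem_supply_region by blast
    have "expectation (\<lambda>\<omega>. l \<bullet> supply_vector (supply_state R t \<omega>) (purchase R t \<omega>))
        \<le> expectation (\<lambda>\<omega>. l \<bullet> v (supply_state R t \<omega>))"
    proof (rule integral_mono)
      show "integrable \<Omega> (\<lambda>\<omega>. l \<bullet> supply_vector (supply_state R t \<omega>) (purchase R t \<omega>))"
        by (intro integrable_inner integrable_supply_vector_nth)
      show "integrable \<Omega> (\<lambda>\<omega>. l \<bullet> v (supply_state R t \<omega>))"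
        using v(1) norm_supply_region_le[OF plant]
        by (intro integrable_inner_selection[OF supply_state_measurable countable_supply_states]) blast
      show "l \<bullet> supply_vector (supply_state R t \<omega>) (purchase R t \<omega>) \<le> l \<bullet> v (supply_state R t \<omega>)"
        if "\<omega> \<in> space \<Omega>" for \<omega>
        using that by (intro v(2) supply_state_mem supply_vector_mem_region purchase_option)
    qed
    with v(1) show "\<exists>v. (\<forall>i\<in>supply_states pl. v i \<in> supply_region pl i) \<and>
        expectation (\<lambda>\<omega>. l \<bullet> supply_vector (supply_state R t \<omega>) (purchase R t \<omega>))
        \<le> expectation (\<lambda>\<omega>. l \<bullet> v (supply_state R t \<omega>))"
      by blast
  qed
  also have "\<dots> = supply_means"
    unfolding supply_means_def
    by (rule weighted_selections_cong) (rule stationary_marginal[OF supply_stationary])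
  finally show ?thesis .
qed


lemma events_of_subset: "f \<in> measurable \<Omega> N \<Longrightarrow> events_of \<Omega> N f \<subseteq> events"
  by (auto simp: events_of_def)

section \<open>Expected sales of one slot\<close>

text \<open>The part of the generating family that matters: current offers and prices are observed before the
  demand, and every generator is an event.\<close>

lemma pre_demand_history_generated:
  obtains G where "pre_demand_history \<Omega> R t = sigma (space \<Omega>) G" "G \<subseteq> events"
    "events_of \<Omega> (count_space UNIV) (offer R t) \<subseteq> G"
    "\<forall>k. events_of \<Omega> borel (\<lambda>\<omega>. price R t \<omega> k) \<subseteq> G"
proof (rule that[OF pre_demand_history_def], goal_cases)
  case 1
  have "supply_state R s \<in> measurable \<Omega> (count_space UNIV)" for s
    by (rule measurable_compose[OF supply_state_measurable]) simp
  moreover have "demand_state R s \<in> measurable \<Omega> (count_space UNIV)" for s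
    by (rule measurable_compose[OF demand_state_measurable]) simp
  ultimately show ?case
    by (intro Un_least UN_least events_of_subset inventory_measurable purchase_measurable
        offer_measurable price_measurable demanded_measurable sold_measurable)
qed blast+

lemma space_pre_demand_history: "space (pre_demand_history \<Omega> R t) = space \<Omega>"
proof -
  obtain G where G: "pre_demand_history \<Omega> R t = sigma (space \<Omega>) G" "G \<subseteq> events"
    by (rule pre_demand_history_generated[of t])
  from G(2) have "G \<subseteq> Pow (space \<Omega>)"
    using sets.space_closed by (rule order_trans)
  then show ?thesis
    unfolding G(1) by (rule space_measure_of)
qed

lemma subalgebra_pre_demand_history: "subalgebra \<Omega> (pre_demand_history \<Omega> R t)"
proof -
  obtain G where G: "pre_demand_history \<Omega> R t = sigma (space \<Omega>) G" "G \<subseteq> events"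
    by (rule pre_demand_history_generated[of t])
  moreover from G(2) have "G \<subseteq> Pow (space \<Omega>)"
    using sets.space_closed by (rule order_trans)
  ultimately show ?thesis
    unfolding subalgebra_def space_pre_demand_history
    by (simp add: sets_measure_of sets.sigma_sets_subset)
qed

lemma pre_demand_history_generators:
  "events_of \<Omega> (count_space UNIV) (offer R t) \<subseteq> sets (pre_demand_history \<Omega> R t)"
  "events_of \<Omega> borel (\<lambda>\<omega>. price R t \<omega> k) \<subseteq> sets (pre_demand_history \<Omega> R t)"
proof -
  obtain G where G: "pre_demand_history \<Omega> R t = sigma (space \<Omega>) G" "G \<subseteq> events"
    "events_of \<Omega> (count_space UNIV) (offer R t) \<subseteq> G"
    "\<forall>k. events_of \<Omega> borel (\<lambda>\<omega>. price R t \<omega> k) \<subseteq> G"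
    by (rule pre_demand_history_generated[of t])
  from G(2) have "G \<subseteq> Pow (space \<Omega>)"
    using sets.space_closed by (rule order_trans)
  then have "G \<subseteq> sets (pre_demand_history \<Omega> R t)"
    unfolding G(1) by (simp add: sets_measure_of sigma_sets_superset_generator)
  with G(3,4) show "events_of \<Omega> (count_space UNIV) (offer R t) \<subseteq> sets (pre_demand_history \<Omega> R t)"
    "events_of \<Omega> borel (\<lambda>\<omega>. price R t \<omega> k) \<subseteq> sets (pre_demand_history \<Omega> R t)"
    by auto
qed

lemma offer_history_measurable:
  "(\<lambda>\<omega>. real_of_int (offer R t \<omega> k)) \<in> borel_measurable (pre_demand_history \<Omega> R t)"
proof -
  have "offer R t \<in> measurable (pre_demand_history \<Omega> R t) (count_space UNIV)"
    using pre_demand_history_generators(1)[of t]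
    by (intro measurableI) (auto simp: space_pre_demand_history events_of_def)
  then show ?thesis
    by (rule measurable_compose) simp
qed

lemma price_history_measurable:
  "(\<lambda>\<omega>. price R t \<omega> k) \<in> borel_measurable (pre_demand_history \<Omega> R t)"
  using pre_demand_history_generators(2)[of t k]
  by (intro measurableI) (auto simp: space_pre_demand_history events_of_def)

lemma mean_demand_measurable:
  "(\<lambda>\<omega>. mean_demand pl k (price R t \<omega> k) (demand_state R t \<omega>)) \<in> borel_measurable \<Omega>"
proof (rule measurable_compose_countable'[OF _ demand_state_measurable countable_demand_states])
  fix y assume y: "y \<in> demand_states pl"
  have "(\<lambda>\<omega>. price R t \<omega> k) \<in> measurable \<Omega> (restrict_space borel (price_set pl k))"
    using price_measurable price_option by (simp add: measurable_restrict_space2_iff)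
  then show "(\<lambda>\<omega>. mean_demand pl k (price R t \<omega> k) y) \<in> borel_measurable \<Omega>"
    by (rule measurable_compose)
      (rule borel_measurable_continuous_on_restrict[OF continuous_mean_demand[OF plant y]])
qed

lemma demanded_component_measurable: "(\<lambda>\<omega>. real_of_int (demanded R t \<omega> k)) \<in> borel_measurable \<Omega>"
  by (rule measurable_compose[OF demanded_measurable]) simp

lemma sold_component_measurable: "(\<lambda>\<omega>. real_of_int (sold R t \<omega> k)) \<in> borel_measurable \<Omega>"
  by (rule measurable_compose[OF sold_measurable]) simp

text \<open>The bounded demand is the finite sum \<open>\<Sum>d. d * 1{D = d}\<close>, and conditioning on the history turns
  each indicator into a point probability of the demand law.\<close>

lemma expectation_demanded:
  assumes H: "H \<in> borel_measurable (pre_demand_history \<Omega> R t)"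
    and bound: "\<And>\<omega>. \<omega> \<in> space \<Omega> \<Longrightarrow> \<bar>H \<omega>\<bar> \<le> B"
  shows "expectation (\<lambda>\<omega>. H \<omega> * real_of_int (demanded R t \<omega> k))
    = expectation (\<lambda>\<omega>. H \<omega> * mean_demand pl k (price R t \<omega> k) (demand_state R t \<omega>))"
proof -
  interpret history: finite_measure_subalgebra \<Omega> "pre_demand_history \<Omega> R t"
    by unfold_locales (rule subalgebra_pre_demand_history)
  let ?S = "{0..int (demand_max pl k)}"
  define I :: "int \<Rightarrow> 'w \<Rightarrow> real" where "I d = indicator {\<omega> \<in> space \<Omega>. demanded R t \<omega> k = d}" for d
  define c where "c d = real_cond_exp \<Omega> (pre_demand_history \<Omega> R t) (I d)" for d
  have H': "H \<in> borel_measurable \<Omega>"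
    using measurable_from_subalg[OF subalgebra_pre_demand_history H] .
  have "{\<omega> \<in> space \<Omega>. demanded R t \<omega> k = d} = demanded R t -` {D. D k = d} \<inter> space \<Omega>" for d
    by auto
  then have "{\<omega> \<in> space \<Omega>. demanded R t \<omega> k = d} \<in> events" for d
    using measurable_sets[OF demanded_measurable, of "{D. D k = d}" t] by simp
  then have I: "I d \<in> borel_measurable \<Omega>" for d
    unfolding I_def by (rule borel_measurable_indicator)
  have HI: "integrable \<Omega> (\<lambda>\<omega>. H \<omega> * I d \<omega>)" for d
  proof (rule integrable_const_bound[where B = B])
    show "AE \<omega> in \<Omega>. norm (H \<omega> * I d \<omega>) \<le> B"
    proof (rule AE_I2)
      fix \<omega> assume "\<omega> \<in> space \<Omega>"
      then have "\<bar>H \<omega>\<bar> \<le> B"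
        by (rule bound)
      then show "norm (H \<omega> * I d \<omega>) \<le> B"
        by (auto simp: I_def indicator_def)
    qed
  qed (use H' I in auto)
  note cond = history.real_cond_exp_intg[OF HI H I, folded c_def]
  have "expectation (\<lambda>\<omega>. H \<omega> * real_of_int (demanded R t \<omega> k))
      = expectation (\<lambda>\<omega>. \<Sum>d\<in>?S. real_of_int d * (H \<omega> * I d \<omega>))"
  proof (rule Bochner_Integration.integral_cong[OF refl])
    fix \<omega> assume \<omega>: "\<omega> \<in> space \<Omega>"
    have "(\<Sum>d\<in>?S. real_of_int d * (H \<omega> * I d \<omega>))
        = (\<Sum>d\<in>?S. if d = demanded R t \<omega> k then H \<omega> * real_of_int d else 0)"
      using \<omega> by (intro sum.cong) (auto simp: I_def indicator_def)
    also have "\<dots> = H \<omega> * real_of_int (demanded R t \<omega> k)"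
      using demanded_range[OF \<omega>] by (subst sum.delta) auto
    finally show "H \<omega> * real_of_int (demanded R t \<omega> k) = (\<Sum>d\<in>?S. real_of_int d * (H \<omega> * I d \<omega>))"
      by simp
  qed
  also have "\<dots> = (\<Sum>d\<in>?S. real_of_int d * expectation (\<lambda>\<omega>. H \<omega> * I d \<omega>))"
    using HI by (subst Bochner_Integration.integral_sum) auto
  also have "\<dots> = (\<Sum>d\<in>?S. real_of_int d * expectation (\<lambda>\<omega>. H \<omega> * c d \<omega>))"
    by (simp add: cond(2))
  also have "\<dots> = expectation (\<lambda>\<omega>. \<Sum>d\<in>?S. real_of_int d * (H \<omega> * c d \<omega>))"
    using cond(1) by (subst Bochner_Integration.integral_sum) auto
  also have "\<dots> = expectation (\<lambda>\<omega>. H \<omega> * mean_demand pl k (price R t \<omega> k) (demand_state R t \<omega>))"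
  \<comment> \<open>The point probabilities are summed to the mean before passing to the demand law: continuity in
         the price, and hence measurability, is known for the mean only.\<close>
  proof (rule integral_cong_AE)
    show "(\<lambda>\<omega>. \<Sum>d\<in>?S. real_of_int d * (H \<omega> * c d \<omega>)) \<in> borel_measurable \<Omega>"
      using cond(1) by (intro borel_measurable_sum borel_measurable_times borel_measurable_const
          borel_measurable_integrable) auto
    show "(\<lambda>\<omega>. H \<omega> * mean_demand pl k (price R t \<omega> k) (demand_state R t \<omega>)) \<in> borel_measurable \<Omega>"
      by (intro borel_measurable_times H' mean_demand_measurable)
    have "AE \<omega> in \<Omega>. \<forall>d\<in>?S. c d \<omega> = pmf (demand_law pl k (price R t \<omega> k) (demand_state R t \<omega>)) d"
      using demand_law by (intro AE_finite_allI) (auto simp: c_def I_def)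
    with AE_space show "AE \<omega> in \<Omega>. (\<Sum>d\<in>?S. real_of_int d * (H \<omega> * c d \<omega>))
        = H \<omega> * mean_demand pl k (price R t \<omega> k) (demand_state R t \<omega>)"
    proof eventually_elim
      case (elim \<omega>)
      then show ?case
        by (simp add: mean_demand_eq_sum[OF plant demand_state_mem price_option] sum_distrib_left mult_ac)
    qed
  qed
  finally show ?thesis .
qed

lemma inner_unit_sale_measurable: "(\<lambda>p. l \<bullet> unit_sale_vector pl k p) \<in> borel_measurable borel"
  by (intro borel_measurable_continuous_onI continuous_intros continuous_unit_sale_vector)

lemma sold_bounds:
  assumes "\<omega> \<in> space \<Omega>"
  shows "0 \<le> real_of_int (sold R t \<omega> k)"
    "real_of_int (sold R t \<omega> k) \<le> real_of_int (offer R t \<omega> k) * real_of_int (demanded R t \<omega> k)"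
    "real_of_int (sold R t \<omega> k) \<le> real (demand_max pl k)"
proof -
  have *: "0 \<le> sold R t \<omega> k" "sold R t \<omega> k \<le> offer R t \<omega> k * demanded R t \<omega> k"
    using sold_range[OF assms] by auto
  then show "0 \<le> real_of_int (sold R t \<omega> k)"
    by simp
  show "real_of_int (sold R t \<omega> k) \<le> real_of_int (offer R t \<omega> k) * real_of_int (demanded R t \<omega> k)"
    using *(2) by (metis of_int_le_iff of_int_mult)
  have "offer R t \<omega> k * demanded R t \<omega> k \<le> int (demand_max pl k)"
    using offer_option[OF assms, of t k] demanded_range[OF assms, of t k] by auto
  with *(2) show "real_of_int (sold R t \<omega> k) \<le> real (demand_max pl k)"
    by linarith
qed

lemma sale_vector_nth:
  "sale_vector t \<omega> $ j = (\<Sum>k\<in>UNIV. real_of_int (sold R t \<omega> k) * unit_sale_vector pl k (price R t \<omega> k) $ j)"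
  by (simp add: sale_vector_def)

lemma integrable_sale_vector_nth: "integrable \<Omega> (\<lambda>\<omega>. sale_vector t \<omega> $ j)"
proof -
  obtain W where W: "\<And>k p. p \<in> price_set pl k \<Longrightarrow> norm (unit_sale_vector pl k p) \<le> W k" "\<And>k. 0 \<le> W k"
    using unit_sale_vector_bounded[OF plant] by blast
  have "integrable \<Omega> (\<lambda>\<omega>. real_of_int (sold R t \<omega> k) * unit_sale_vector pl k (price R t \<omega> k) $ j)" for k
  proof (rule integrable_const_bound[where B = "real (demand_max pl k) * W k"])
    have "(\<lambda>\<omega>. unit_sale_vector pl k (price R t \<omega> k) $ j) \<in> borel_measurable \<Omega>"
      using price_measurable[of t k] by (cases j) simp_all
    then show "(\<lambda>\<omega>. real_of_int (sold R t \<omega> k) * unit_sale_vector pl k (price R t \<omega> k) $ j) \<in> borel_measurable \<Omega>"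
      by (intro borel_measurable_times sold_component_measurable)
    show "AE \<omega> in \<Omega>. norm (real_of_int (sold R t \<omega> k) * unit_sale_vector pl k (price R t \<omega> k) $ j)
        \<le> real (demand_max pl k) * W k"
    proof (rule AE_I2)
      fix \<omega> assume \<omega>: "\<omega> \<in> space \<Omega>"
      have "\<bar>unit_sale_vector pl k (price R t \<omega> k) $ j\<bar> \<le> W k"
        using W(1)[OF price_option[OF \<omega>]] component_le_norm_cart order_trans by blast
      then show "norm (real_of_int (sold R t \<omega> k) * unit_sale_vector pl k (price R t \<omega> k) $ j)
        \<le> real (demand_max pl k) * W k"
        using sold_bounds(1,3)[OF \<omega>] by (simp add: abs_mult mult_mono)
    qed
  qed
  then show ?thesis
    unfolding sale_vector_nth by (rule Bochner_Integration.integrable_sum)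
qed

text \<open>The direction \<open>l\<close> values one unit of product \<open>k\<close> at \<open>l \<bullet> unit_sale_vector pl k p\<close>. Sales are worth at most
  what they would be worth if all demand for offered products of positive value, and nothing else,
  were served. The factor \<open>H k\<close> multiplying the demand is known before the demand is generated, so the
  demand may be replaced by its conditional mean. What remains is the payoff of the decision that
  withdraws the products of nonpositive value.\<close>

lemma expectation_inner_sale_le:
  assumes v: "\<forall>y\<in>demand_states pl. v y \<in> demand_region pl y"
    and max: "\<And>y u. y \<in> demand_states pl \<Longrightarrow> u \<in> demand_region pl y \<Longrightarrow> l \<bullet> u \<le> l \<bullet> v y"
  shows "expectation (\<lambda>\<omega>. l \<bullet> sale_vector t \<omega>) \<le> expectation (\<lambda>\<omega>. l \<bullet> v (demand_state R t \<omega>))"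
proof -
  obtain W where W: "\<And>k p. p \<in> price_set pl k \<Longrightarrow> norm (unit_sale_vector pl k p) \<le> W k" "\<And>k. 0 \<le> W k"
    using unit_sale_vector_bounded[OF plant] by blast
  define H where "H k \<omega> = max 0 (l \<bullet> unit_sale_vector pl k (price R t \<omega> k)) * real_of_int (offer R t \<omega> k)" for k \<omega>
  define F where "F k \<omega> = mean_demand pl k (price R t \<omega> k) (demand_state R t \<omega>)" for k \<omega>
  have H: "H k \<in> borel_measurable (pre_demand_history \<Omega> R t)" for k
    unfolding H_def
    by (intro borel_measurable_times borel_measurable_max borel_measurable_const offer_history_measurable
        measurable_compose[OF price_history_measurable inner_unit_sale_measurable])
  have H': "H k \<in> borel_measurable \<Omega>" for k
    using measurable_from_subalg[OF subalgebra_pre_demand_history H] .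
  have H_bound: "0 \<le> H k \<omega>" "\<bar>H k \<omega>\<bar> \<le> norm l * W k" if \<omega>: "\<omega> \<in> space \<Omega>" for k \<omega>
  proof -
    have "\<bar>l \<bullet> unit_sale_vector pl k (price R t \<omega> k)\<bar> \<le> norm l * W k"
      using W(1)[OF price_option[OF \<omega>]]
      by (meson Cauchy_Schwarz_ineq2 mult_left_mono norm_ge_zero order_trans)
    moreover have "offer R t \<omega> k = 0 \<or> offer R t \<omega> k = 1"
      using offer_option[OF \<omega>, of t k] by blast
    ultimately show "0 \<le> H k \<omega>" "\<bar>H k \<omega>\<bar> \<le> norm l * W k"
      using W(2)[of k] by (auto simp: H_def)
  qed
  have int_HD: "integrable \<Omega> (\<lambda>\<omega>. H k \<omega> * real_of_int (demanded R t \<omega> k))" for k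
  proof (rule integrable_const_bound[where B = "norm l * W k * real (demand_max pl k)"])
    show "AE \<omega> in \<Omega>. norm (H k \<omega> * real_of_int (demanded R t \<omega> k)) \<le> norm l * W k * real (demand_max pl k)"
    proof (rule AE_I2)
      fix \<omega> assume \<omega>: "\<omega> \<in> space \<Omega>"
      then show "norm (H k \<omega> * real_of_int (demanded R t \<omega> k)) \<le> norm l * W k * real (demand_max pl k)"
        unfolding real_norm_def abs_mult using demanded_range[OF \<omega>, of t k] W(2)
        by (intro mult_mono H_bound) auto
    qed
  qed (intro borel_measurable_times H' demanded_component_measurable)
  have int_HF: "integrable \<Omega> (\<lambda>\<omega>. H k \<omega> * F k \<omega>)" for k
  proof (rule integrable_const_bound[where B = "norm l * W k * real (demand_max pl k)"])
    show "AE \<omega> in \<Omega>. norm (H k \<omega> * F k \<omega>) \<le> norm l * W k * real (demand_max pl k)"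
    proof (rule AE_I2)
      fix \<omega> assume \<omega>: "\<omega> \<in> space \<Omega>"
      then show "norm (H k \<omega> * F k \<omega>) \<le> norm l * W k * real (demand_max pl k)"
        unfolding real_norm_def abs_mult F_def
        using mean_demand_bounds[OF plant demand_state_mem[OF \<omega>] price_option[OF \<omega>]] W(2)
        by (intro mult_mono H_bound) auto
    qed
  qed (unfold F_def, intro borel_measurable_times H' mean_demand_measurable)
  have "expectation (\<lambda>\<omega>. l \<bullet> sale_vector t \<omega>)
      \<le> expectation (\<lambda>\<omega>. \<Sum>k\<in>UNIV. H k \<omega> * real_of_int (demanded R t \<omega> k))"
  proof (rule integral_mono)
    show "integrable \<Omega> (\<lambda>\<omega>. l \<bullet> sale_vector t \<omega>)"
      by (intro integrable_inner integrable_sale_vector_nth)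
    show "integrable \<Omega> (\<lambda>\<omega>. \<Sum>k\<in>UNIV. H k \<omega> * real_of_int (demanded R t \<omega> k))"
      using int_HD by (rule Bochner_Integration.integrable_sum)
    fix \<omega> assume \<omega>: "\<omega> \<in> space \<Omega>"
    have "real_of_int (sold R t \<omega> k) * (l \<bullet> unit_sale_vector pl k (price R t \<omega> k))
        \<le> H k \<omega> * real_of_int (demanded R t \<omega> k)" for k
    proof -
      have "real_of_int (sold R t \<omega> k) * (l \<bullet> unit_sale_vector pl k (price R t \<omega> k))
          \<le> real_of_int (sold R t \<omega> k) * max 0 (l \<bullet> unit_sale_vector pl k (price R t \<omega> k))"
        using sold_bounds(1)[OF \<omega>] by (intro mult_left_mono) auto
      also have "\<dots> \<le> (real_of_int (offer R t \<omega> k) * real_of_int (demanded R t \<omega> k))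
          * max 0 (l \<bullet> unit_sale_vector pl k (price R t \<omega> k))"
        using sold_bounds(2)[OF \<omega>] by (intro mult_right_mono) auto
      finally show ?thesis
        by (simp add: H_def mult_ac)
    qed
    then show "l \<bullet> sale_vector t \<omega> \<le> (\<Sum>k\<in>UNIV. H k \<omega> * real_of_int (demanded R t \<omega> k))"
      by (simp add: sale_vector_def inner_sum_right sum_mono)
  qed
  also have "\<dots> = (\<Sum>k\<in>UNIV. expectation (\<lambda>\<omega>. H k \<omega> * real_of_int (demanded R t \<omega> k)))"
    using int_HD by (rule Bochner_Integration.integral_sum)
  also have "\<dots> = (\<Sum>k\<in>UNIV. expectation (\<lambda>\<omega>. H k \<omega> * F k \<omega>))"
    unfolding F_def using H H_bound(2) by (intro sum.cong refl expectation_demanded) auto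
  also have "\<dots> = expectation (\<lambda>\<omega>. \<Sum>k\<in>UNIV. H k \<omega> * F k \<omega>)"
    using int_HF by (rule Bochner_Integration.integral_sum[symmetric])
  also have "\<dots> \<le> expectation (\<lambda>\<omega>. l \<bullet> v (demand_state R t \<omega>))"
  proof (rule integral_mono)
    show "integrable \<Omega> (\<lambda>\<omega>. \<Sum>k\<in>UNIV. H k \<omega> * F k \<omega>)"
      using int_HF by (rule Bochner_Integration.integrable_sum)
    obtain B where "\<And>y u. y \<in> demand_states pl \<Longrightarrow> u \<in> demand_region pl y \<Longrightarrow> norm u \<le> B"
      using norm_demand_region_bounded[OF plant] by metis
    then show "integrable \<Omega> (\<lambda>\<omega>. l \<bullet> v (demand_state R t \<omega>))"
      using v by (intro integrable_inner_selection[OF demand_state_measurable countable_demand_states]) blast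
    fix \<omega> assume \<omega>: "\<omega> \<in> space \<Omega>"
    define z where "z k = (if l \<bullet> unit_sale_vector pl k (price R t \<omega> k) > 0 then offer R t \<omega> k else 0)" for k
    have "(z, price R t \<omega>) \<in> offer_prices pl"
      using offer_option[OF \<omega>, of t] price_option[OF \<omega>] by (auto simp: offer_prices_def z_def)
    then have "l \<bullet> demand_vector pl (demand_state R t \<omega>) (z, price R t \<omega>) \<le> l \<bullet> v (demand_state R t \<omega>)"
      by (intro max demand_state_mem \<omega> demand_vector_mem_region)
    also have "l \<bullet> demand_vector pl (demand_state R t \<omega>) (z, price R t \<omega>) = (\<Sum>k\<in>UNIV. H k \<omega> * F k \<omega>)"
      unfolding demand_vector_def inner_sum_right
      by (intro sum.cong refl) (simp add: z_def H_def F_def max_def)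
    finally show "(\<Sum>k\<in>UNIV. H k \<omega> * F k \<omega>) \<le> l \<bullet> v (demand_state R t \<omega>)" .
  qed
  finally show ?thesis .
qed

lemma mean_sale_mem: "mean_sale t \<in> demand_means"
proof -
  obtain B where B: "\<And>y u. y \<in> demand_states pl \<Longrightarrow> u \<in> demand_region pl y \<Longrightarrow> norm u \<le> B"
    using norm_demand_region_bounded[OF plant] by metis
  have "mean_sale t \<in> weighted_selections (\<lambda>y. prob {\<omega> \<in> space \<Omega>. demand_state R t \<omega> = y})
      (demand_states pl) (demand_region pl)"
    unfolding mean_sale_def
  proof (rule expectation_vector_mem_weighted_selections[OF demand_state_measurable countable_demand_states
        compact_demand_region[OF plant] convex_demand_region B integrable_sale_vector_nth])
    fix l
    obtain v where v: "\<forall>y\<in>demand_states pl. v y \<in> demand_region pl y"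
      "\<And>y u. y \<in> demand_states pl \<Longrightarrow> u \<in> demand_region pl y \<Longrightarrow> l \<bullet> u \<le> l \<bullet> v y"
      using maximal_selection[of "demand_states pl" "demand_region pl" l] compact_demand_region[OF plant]
        zero_mem_demand_region[OF plant] by blast
    show "\<exists>v. (\<forall>i\<in>demand_states pl. v i \<in> demand_region pl i) \<and>
        expectation (\<lambda>\<omega>. l \<bullet> sale_vector t \<omega>) \<le> expectation (\<lambda>\<omega>. l \<bullet> v (demand_state R t \<omega>))"
      using v(1) expectation_inner_sale_le[OF v] by blast
  qed
  also have "\<dots> = demand_means"
    unfolding demand_means_def
    by (rule weighted_selections_cong) (rule stationary_marginal[OF demand_stationary])
  finally show ?thesis .
qed

section \<open>Inventory balance and time averages\<close>

lemma material_used_bounds: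
  assumes "\<omega> \<in> space \<Omega>"
  shows "0 \<le> material_used pl R t \<omega> m" "material_used pl R t \<omega> m \<le> inventory R t \<omega> m"
  using sold_range[OF assms] sold_supplied[OF assms] by (auto simp: material_used_def intro!: sum_nonneg)

lemma sale_vector_Some: "sale_vector t \<omega> $ Some m = real_of_int (material_used pl R t \<omega> m)"
  by (simp add: sale_vector_nth material_used_def mult.commute)

lemma actual_profit_eq:
  assumes "\<omega> \<in> space \<Omega>"
  shows "actual_profit pl R t \<omega>
    = supply_vector (supply_state R t \<omega>) (purchase R t \<omega>) $ None + sale_vector t \<omega> $ None"
proof -
  have *: "real_of_int (offer R t \<omega> k) * real_of_int (sold R t \<omega> k) * c = real_of_int (sold R t \<omega> k) * c" for k c
    using offer_option[OF assms, of t k] sold_bounds(1,2)[OF assms, of t k] by auto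
  show ?thesis
    unfolding actual_profit_def sale_vector_nth supply_vector_nth unit_sale_vector_nth * ..
qed

lemma expectation_actual_profit: "expectation (actual_profit pl R t) = mean_supply t $ None + mean_sale t $ None"
proof -
  have "expectation (actual_profit pl R t) = expectation (\<lambda>\<omega>.
      supply_vector (supply_state R t \<omega>) (purchase R t \<omega>) $ None + sale_vector t \<omega> $ None)"
    by (rule Bochner_Integration.integral_cong[OF refl actual_profit_eq])
  also have "\<dots> = mean_supply t $ None + mean_sale t $ None"
    unfolding mean_supply_def mean_sale_def vec_lambda_beta
    by (intro Bochner_Integration.integral_add integrable_supply_vector_nth integrable_sale_vector_nth)
  finally show ?thesis .
qed

text \<open>The maximum in the queue update is never active, since sales are limited by the inventory.\<close>

lemma inventory_eq:
  assumes "\<omega> \<in> space \<Omega>"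
  shows "inventory R n \<omega> m = inventory R 0 \<omega> m + (\<Sum>t<n. purchase R t \<omega> m) - (\<Sum>t<n. material_used pl R t \<omega> m)"
proof (induction n)
  case (Suc n)
  then show ?case
    using inventory_update[OF assms, of n m] material_used_bounds(2)[OF assms, of n m] by simp
qed simp

lemma inventory_balance:
  assumes "\<And>m. integrable \<Omega> (\<lambda>\<omega>. real_of_int (inventory R 0 \<omega> m))"
  shows "(\<Sum>t<n. mean_sale t $ Some m)
    \<le> (\<Sum>t<n. mean_supply t $ Some m) + expectation (\<lambda>\<omega>. real_of_int (inventory R 0 \<omega> m))"
proof -
  let ?a = "\<lambda>t \<omega>. supply_vector (supply_state R t \<omega>) (purchase R t \<omega>) $ Some m"
  have "(\<Sum>t<n. mean_sale t $ Some m) = expectation (\<lambda>\<omega>. \<Sum>t<n. sale_vector t \<omega> $ Some m)"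
    using integrable_sale_vector_nth by (simp add: mean_sale_def)
  also have "\<dots> \<le> expectation (\<lambda>\<omega>. (\<Sum>t<n. ?a t \<omega>) + real_of_int (inventory R 0 \<omega> m))"
  proof (rule integral_mono)
    show "integrable \<Omega> (\<lambda>\<omega>. \<Sum>t<n. sale_vector t \<omega> $ Some m)"
      by (intro Bochner_Integration.integrable_sum integrable_sale_vector_nth)
    show "integrable \<Omega> (\<lambda>\<omega>. (\<Sum>t<n. ?a t \<omega>) + real_of_int (inventory R 0 \<omega> m))"
      by (intro Bochner_Integration.integrable_add Bochner_Integration.integrable_sum
          integrable_supply_vector_nth assms)
    fix \<omega> assume \<omega>: "\<omega> \<in> space \<Omega>"
    have "(\<Sum>t<n. material_used pl R t \<omega> m) \<le> (\<Sum>t<n. purchase R t \<omega> m) + inventory R 0 \<omega> m"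
      using inventory_eq[OF \<omega>, of n m] material_used_bounds[OF \<omega>, of n m] by linarith
    then have "real_of_int (\<Sum>t<n. material_used pl R t \<omega> m)
        \<le> real_of_int ((\<Sum>t<n. purchase R t \<omega> m) + inventory R 0 \<omega> m)"
      by (simp only: of_int_le_iff)
    then show "(\<Sum>t<n. sale_vector t \<omega> $ Some m) \<le> (\<Sum>t<n. ?a t \<omega>) + real_of_int (inventory R 0 \<omega> m)"
      by (simp add: sale_vector_Some)
  qed
  also have "\<dots> = (\<Sum>t<n. mean_supply t $ Some m) + expectation (\<lambda>\<omega>. real_of_int (inventory R 0 \<omega> m))"
    using integrable_supply_vector_nth[of _ "Some m"] assms by (simp add: mean_supply_def)
  finally show ?thesis .
qed

end

theorem theorem1:
  fixes \<Omega> :: "'w measure"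
    and pl :: "('m::finite, 'k::finite, 'y) plant"
    and R :: "('w, 'm, 'k, 'y) run"
  assumes "controlled_plant \<Omega> pl R"
    and "\<And>m. integrable \<Omega> (\<lambda>\<omega>. real_of_int (inventory R 0 \<omega> m))"
  shows "\<exists>\<phi>_opt. is_program_max pl (state_prob \<Omega> (supply_state R)) (state_prob \<Omega> (demand_state R)) \<phi>_opt \<and>
    limsup (\<lambda>t. ereal (1 / real t * (\<Sum>\<tau><t. \<integral>\<omega>. actual_profit pl R \<tau> \<omega> \<partial>\<Omega>))) \<le> ereal \<phi>_opt"
proof -
  interpret controlled_plant \<Omega> pl R by fact
  let ?value = "program_value pl (state_prob \<Omega> (supply_state R)) (state_prob \<Omega> (demand_state R))"
  obtain B where demand_family: "bounded_family (state_prob \<Omega> (demand_state R)) (demand_states pl) (demand_region pl) B"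
    by (rule demand_family)
  have value_iff: "?value \<phi> \<longleftrightarrow> (\<exists>u\<in>supply_means. \<exists>v\<in>demand_means.
      (\<forall>m. v $ Some m \<le> u $ Some m) \<and> \<phi> = u $ None + v $ None)" for \<phi>
    unfolding supply_means_def demand_means_def
    using program_value_imp_selections[OF plant supply_family demand_family]
      selections_imp_program_value[OF plant supply_family demand_family] by (rule iffI)
  obtain u v where uv: "u \<in> supply_means" "v \<in> demand_means" "\<forall>m. v $ Some m \<le> u $ Some m"
    and opt: "\<forall>u'\<in>supply_means. \<forall>v'\<in>demand_means. (\<forall>m. v' $ Some m \<le> u' $ Some m)
       \<longrightarrow> u' $ None + v' $ None \<le> u $ None + v $ None"
    using optimum_attained[OF supply_means_properties(1) demand_means_properties(1)
          supply_means_properties(3) demand_means_properties(3)] by blast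
  define \<phi>_opt where "\<phi>_opt = u $ None + v $ None"
  have "?value \<phi>_opt"
    unfolding value_iff \<phi>_opt_def using uv by blast
  moreover have "\<forall>\<psi>. ?value \<psi> \<longrightarrow> \<psi> \<le> \<phi>_opt"
    unfolding value_iff \<phi>_opt_def using opt by blast
  ultimately have "is_program_max pl (state_prob \<Omega> (supply_state R)) (state_prob \<Omega> (demand_state R)) \<phi>_opt"
    by (simp add: is_program_max_def)
  moreover have "limsup (\<lambda>t. ereal (1 / real t * (\<Sum>\<tau><t. expectation (actual_profit pl R \<tau>)))) \<le> ereal \<phi>_opt"
  proof -
    define f where "f n = (1 / real n) *\<^sub>R (\<Sum>t<n. mean_supply t)" for n
    define g where "g n = (1 / real n) *\<^sub>R (\<Sum>t<n. mean_sale t)" for n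
    define e where "e m n = expectation (\<lambda>\<omega>. real_of_int (inventory R 0 \<omega> m)) / real n" for m n
    have f: "f n \<in> supply_means" and g: "g n \<in> demand_means" for n
      unfolding f_def g_def
      by (intro time_average_mem supply_means_properties demand_means_properties mean_supply_mem mean_sale_mem)+
    have gap: "g n $ Some m \<le> f n $ Some m + e m n" for n m
    proof -
      have "(1 / real n) * (\<Sum>t<n. mean_sale t $ Some m)
          \<le> (1 / real n) * ((\<Sum>t<n. mean_supply t $ Some m) + expectation (\<lambda>\<omega>. real_of_int (inventory R 0 \<omega> m)))"
        by (intro mult_left_mono inventory_balance assms(2)) simp
      then show ?thesis
        by (simp add: f_def g_def e_def add_divide_distrib)
    qed
    have "e m \<longlonglongrightarrow> 0" for m
      unfolding e_def by (rule lim_const_over_n)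
    then have "limsup (\<lambda>n. ereal (f n $ None + g n $ None)) \<le> ereal \<phi>_opt"
      by (intro limsup_almost_feasible_le[OF supply_means_properties(1) demand_means_properties(1) _ f g gap])
        (auto simp: \<phi>_opt_def opt)
    also have "(\<lambda>n. ereal (f n $ None + g n $ None))
        = (\<lambda>t. ereal (1 / real t * (\<Sum>\<tau><t. expectation (actual_profit pl R \<tau>))))"
      by (simp add: f_def g_def expectation_actual_profit sum.distrib add_divide_distrib)
    finally show ?thesis .
  qed
  ultimately show ?thesis
    by blast
qed

end
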